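(* For every positive integer $n$, every properly edge-coloured complete graph $K_n$ (with any number of colours) contains at least $n/10^{12}$ pairwise edge-disjoint rainbow spanning trees.
   Context: An edge-colouring is proper if any two edges sharing a vertex have distinct colours. A subgraph of an edge-coloured graph is rainbow if its edges have pairwise distinct colours. A rainbow spanning tree of $K_n$ is a tree with vertex set $V(K_n)$ that is a rainbow subgraph of $K_n$. *)

theory Defs
  imports Complex_Main
begin

text \<open>
  A finite simple graph is a pair of a vertex set and a set of two-element sets of vertices.
  The undirected notions are defined here because the \<open>forest\<close> and \<open>tree\<close> of the AFP entry
  \<open>Graph_Theory\<close> speak about directed cycles only.
\<close>

type_synonym 'a ugraph = "'a set \<times> 'a set set"

abbreviation ug_verts :: "'a ugraph \<Rightarrow> 'a set" where
  "ug_verts G \<equiv> fst G"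

abbreviation ug_edges :: "'a ugraph \<Rightarrow> 'a set set" where
  "ug_edges G \<equiv> snd G"

definition simple_ugraph :: "'a ugraph \<Rightarrow> bool" where
  "simple_ugraph G \<longleftrightarrow>
     finite (ug_verts G) \<and> (\<forall>e\<in>ug_edges G. e \<subseteq> ug_verts G \<and> card e = 2)"

definition complete_ugraph :: "'a set \<Rightarrow> 'a ugraph" where
  "complete_ugraph V = (V, {e. e \<subseteq> V \<and> card e = 2})"

definition ug_subgraph :: "'a ugraph \<Rightarrow> 'a ugraph \<Rightarrow> bool" where
  "ug_subgraph H G \<longleftrightarrow> ug_verts H \<subseteq> ug_verts G \<and> ug_edges H \<subseteq> ug_edges G"

definition ug_walk :: "'a ugraph \<Rightarrow> 'a list \<Rightarrow> bool" where
  "ug_walk G p \<longleftrightarrow>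
     p \<noteq> [] \<and> set p \<subseteq> ug_verts G \<and> successively (\<lambda>u v. {u, v} \<in> ug_edges G) p"

definition ug_connected :: "'a ugraph \<Rightarrow> bool" where
  "ug_connected G \<longleftrightarrow>
     ug_verts G \<noteq> {} \<and>
     (\<forall>u\<in>ug_verts G. \<forall>v\<in>ug_verts G. \<exists>p. ug_walk G p \<and> hd p = u \<and> last p = v)"

text \<open>A cycle is given by its distinct vertices in order; the first is not repeated at the end.\<close>

definition ug_cycle :: "'a ugraph \<Rightarrow> 'a list \<Rightarrow> bool" where
  "ug_cycle G p \<longleftrightarrow>
     ug_walk G p \<and> 3 \<le> length p \<and> distinct p \<and> {last p, hd p} \<in> ug_edges G"

definition ug_tree :: "'a ugraph \<Rightarrow> bool" where
  "ug_tree G \<longleftrightarrow> simple_ugraph G \<and> ug_connected G \<and> (\<nexists>p. ug_cycle G p)"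

text \<open>A colouring is a function on all sets; only its values on edges matter.\<close>

definition proper_edge_colouring :: "('a set \<Rightarrow> 'c) \<Rightarrow> 'a ugraph \<Rightarrow> bool" where
  "proper_edge_colouring c G \<longleftrightarrow>
     (\<forall>e\<in>ug_edges G. \<forall>f\<in>ug_edges G. e \<noteq> f \<and> e \<inter> f \<noteq> {} \<longrightarrow> c e \<noteq> c f)"

definition rainbow :: "('a set \<Rightarrow> 'c) \<Rightarrow> 'a ugraph \<Rightarrow> bool" where
  "rainbow c H \<longleftrightarrow> inj_on c (ug_edges H)"

definition rainbow_spanning_tree ::
    "('a set \<Rightarrow> 'c) \<Rightarrow> 'a ugraph \<Rightarrow> 'a ugraph \<Rightarrow> bool" where
  "rainbow_spanning_tree c G T \<longleftrightarrow>
     ug_tree T \<and> ug_subgraph T G \<and> ug_verts T = ug_verts G \<and> rainbow c T"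

end

theory Submission
  imports Defs
begin

text \<open>
  Write \<open>col v\<close> for the set of colours at \<open>v\<close> and \<open>d u v\<close> for the number of colours at \<open>u\<close>
  missing at \<open>v\<close>; since all vertices see the same number of colours, \<open>d\<close> is a pseudometric. We
  take about \<open>n / 10\<^sup>1\<^sup>2\<close> roots whose average distances to all vertices are comparable and that
  span few edges of rare colours. For each root \<open>i\<close> we start from the rainbow star that joins \<open>i\<close>
  to all non-roots and repeatedly hang a vertex \<open>y\<close> below a current child \<open>z\<close> of \<open>i\<close>, where
  \<open>{y, z}\<close> is unused and has a colour not occurring in the tree; this frees the old colour of
  \<open>y\<close>. The \<open>i\<close>-tree thereby gives up edges \<open>{i, x}\<close>, which the other trees use to reach \<open>i\<close>.
  When a tree takes in a root \<open>j\<close> by an edge \<open>{j, x}\<close> given up by the \<open>j\<close>-tree, the colour of that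
  edge is released by one or two such moves. They succeed because either the vertex to be moved sees
  many foreign colours (not in \<open>col i\<close>), or nearly all colours at \<open>i\<close> are available at it; and because a
  free colour with a large class (or a large supply of foreign colours) offers linearly many moves,
  whereas only a much smaller number of edges, vertices and colours is blocked.

  If few foreign colours exist, the free colours of the \<open>i\<close>-tree are initially those of the edges
  from \<open>i\<close> to the other roots. The rare ones among them are useless and have to be replaced. A rare
  colour at \<open>i\<close> is missing at most vertices, so it forces many foreign edges; by the choice of the
  roots these outnumber the replacements that are needed.
\<close>

section \<open>Trees given by parent functions\<close>

lemma ug_walk_append:
  assumes "ug_walk G p" and "ug_walk G q" and "last p = hd q"
  shows "ug_walk G (p @ tl q)" and "hd (p @ tl q) = hd p" and "last (p @ tl q) = last q"
proof -
  have p: "p \<noteq> []" and q: "q \<noteq> []"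
    using assms by (auto simp: ug_walk_def)
  obtain a q' where q': "q = a # q'" using q by (cases q) auto
  show "hd (p @ tl q) = hd p" using p by simp
  show "last (p @ tl q) = last q" using assms(3) p q' by (cases q') auto
  have "successively (\<lambda>u v. {u, v} \<in> ug_edges G) (p @ q')"
    using assms q' p by (cases q') (auto simp: ug_walk_def successively_append_iff)
  then show "ug_walk G (p @ tl q)"
    using assms q' p by (auto simp: ug_walk_def)
qed

lemma ug_walk_rev: "ug_walk G p \<Longrightarrow> ug_walk G (rev p)"
  by (auto simp: ug_walk_def successively_rev insert_commute)

text \<open>Passing to the parent lowers the rank \<open>\<rho>\<close>, so every vertex reaches
  \<open>r\<close>. On a cycle, a vertex of maximal rank could only have its own parent as neighbour
  on either side, but its two neighbours are distinct.\<close>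

lemma ug_tree_parents:
  fixes f :: "'a \<Rightarrow> 'a" and \<rho> :: "'a \<Rightarrow> nat"
  assumes fin: "finite V" and r: "r \<in> V"
    and par: "\<And>v. v \<in> V - {r} \<Longrightarrow> f v \<in> V \<and> \<rho> (f v) < \<rho> v"
  shows "ug_tree (V, (\<lambda>v. {v, f v}) ` (V - {r}))" (is "ug_tree ?G")
proof -
  have simple: "simple_ugraph ?G"
    unfolding simple_ugraph_def
  proof (intro conjI ballI)
    show "finite (ug_verts ?G)" using fin by simp
    fix e assume "e \<in> ug_edges ?G"
    then obtain v where v: "v \<in> V - {r}" "e = {v, f v}" by auto
    then have "f v \<noteq> v" using par[OF v(1)] by auto
    then show "e \<subseteq> ug_verts ?G" "card e = 2" using v par[OF v(1)] by auto
  qed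
  have root_walk: "\<exists>p. ug_walk ?G p \<and> hd p = v \<and> last p = r" if "v \<in> V" for v
    using that
  proof (induction "\<rho> v" arbitrary: v rule: less_induct)
    case less
    show ?case
    proof (cases "v = r")
      case True
      then have "ug_walk ?G [v]" using less by (simp add: ug_walk_def)
      then show ?thesis using True by (intro exI[of _ "[v]"]) simp
    next
      case False
      then obtain p where p: "ug_walk ?G p" "hd p = f v" "last p = r"
        using less par[of v] by blast
      have e: "ug_walk ?G [v, f v]" using less False par[of v] by (auto simp: ug_walk_def)
      show ?thesis
        using ug_walk_append[OF e p(1)] p by (metis last.simps list.distinct(1) list.sel(1))
    qed
  qed
  have "ug_connected ?G"
    unfolding ug_connected_def
  proof (intro conjI ballI)
    show "ug_verts ?G \<noteq> {}" using r by auto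
    fix u v assume "u \<in> ug_verts ?G" "v \<in> ug_verts ?G"
    then obtain p q where p: "ug_walk ?G p" "hd p = u" "last p = r"
      and q: "ug_walk ?G q" "hd q = v" "last q = r" using root_walk[of u] root_walk[of v] by auto
    have "q \<noteq> []" using q by (auto simp: ug_walk_def)
    then have l: "last p = hd (rev q)" "last (rev q) = v"
      using p q by (auto simp: hd_rev last_rev)
    show "\<exists>p. ug_walk ?G p \<and> hd p = u \<and> last p = v"
      using ug_walk_append[OF p(1) ug_walk_rev[OF q(1)] l(1)] p l by metis
  qed
  moreover have "\<not> ug_cycle ?G p" for p
  proof
    assume cyc: "ug_cycle ?G p"
    define L where "L = length p"
    have L: "L \<ge> 3" and dist: "distinct p" and walk: "ug_walk ?G p"
      and close: "{last p, hd p} \<in> ug_edges ?G"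
      using cyc by (auto simp: ug_cycle_def L_def)
    have edge: "{p ! k, p ! (Suc k mod L)} \<in> ug_edges ?G" if "k < L" for k
    proof (cases "Suc k = L")
      case True
      then show ?thesis using close L
        by (metis L_def diff_Suc_1 hd_conv_nth last_conv_nth length_0_conv mod_self not_numeral_le_zero)
    next
      case False
      then show ?thesis using that walk
        by (auto simp: ug_walk_def successively_conv_nth L_def)
    qed
    have "finite {..<L}" "{..<L} \<noteq> {}" using L by (auto simp: lessThan_empty_iff)
    then obtain k where k: "k < L" and max: "\<And>l. l < L \<Longrightarrow> \<rho> (p ! l) \<le> \<rho> (p ! k)"
      using finite_imageI[of "{..<L}" "\<lambda>l. \<rho> (p ! l)"]
        Max_in[of "(\<lambda>l. \<rho> (p ! l)) ` {..<L}"] Max_ge[of "(\<lambda>l. \<rho> (p ! l)) ` {..<L}"]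
      by (smt (verit, best) image_iff image_is_empty lessThan_iff)
    have up: "w = f (p ! k)"
      if e: "{p ! k, w} \<in> ug_edges ?G" and "\<rho> w \<le> \<rho> (p ! k)" for w
    proof -
      obtain v where v: "v \<in> V - {r}" "{p ! k, w} = {v, f v}" using e by auto
      then show ?thesis using par[OF v(1)] \<open>\<rho> w \<le> \<rho> (p ! k)\<close> by (auto simp: doubleton_eq_iff)
    qed
    \<comment> \<open>The cyclic successor and predecessor of \<open>k\<close>; they differ because
      \<open>L\<close> is at least 3.\<close>
    define a b where "a = Suc k mod L" and "b = (if k = 0 then L - 1 else k - 1)"
    have ab: "a < L" "b < L" "Suc b mod L = k" using L k by (auto simp: a_def b_def)
    have "a \<noteq> b"
    proof (cases "Suc k = L")
      case True then show ?thesis using L by (auto simp: a_def b_def)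
    next
      case False then show ?thesis using L k by (auto simp: a_def b_def)
    qed
    have "p ! a = f (p ! k)" using up edge[OF k] max ab by (simp add: a_def)
    moreover have "p ! b = f (p ! k)" using up edge[of b] max ab by (simp add: insert_commute)
    ultimately show False
      using dist \<open>a \<noteq> b\<close> ab by (metis L_def nth_eq_iff_index_eq)
  qed
  ultimately show ?thesis using simple by (auto simp: ug_tree_def)
qed

section \<open>Proper colourings of complete graphs\<close>

locale proper_colouring =
  fixes V :: "'a set" and k :: "'a \<Rightarrow> 'a \<Rightarrow> 'c"
  assumes finite_V: "finite V"
    and k_commute: "k u v = k v u"
    and k_inj: "\<lbrakk>u \<in> V; v \<in> V; w \<in> V; v \<noteq> u; w \<noteq> u; k u v = k u w\<rbrakk> \<Longrightarrow> v = w"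
begin

definition col :: "'a \<Rightarrow> 'c set" where
  "col v = k v ` (V - {v})"

definition d :: "'a \<Rightarrow> 'a \<Rightarrow> nat" where
  "d u v = card (col u - col v)"

definition dsum :: "'a \<Rightarrow> nat" where
  "dsum v = (\<Sum>w\<in>V. d v w)"

text \<open>Every edge is counted in both orientations. As the classes of a proper colouring are matchings,
  \<open>card (pairs {c})\<close> is the number of vertices that see the colour \<open>c\<close>.\<close>

definition pairs :: "'c set \<Rightarrow> ('a \<times> 'a) set" where
  "pairs C = {(y, z). y \<in> V \<and> z \<in> V \<and> y \<noteq> z \<and> k y z \<in> C}"

lemma k_inj_on: "u \<in> V \<Longrightarrow> inj_on (k u) (V - {u})"
  by (auto simp: inj_on_def intro: k_inj)

lemma finite_col [simp]: "finite (col v)"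
  by (simp add: col_def finite_V)

lemma finite_pairs [simp]: "finite (pairs C)"
  by (rule finite_subset[of _ "V \<times> V"]) (auto simp: pairs_def finite_V)

lemma k_in_col: "\<lbrakk>u \<in> V; v \<in> V; u \<noteq> v\<rbrakk> \<Longrightarrow> k u v \<in> col u \<and> k u v \<in> col v"
  unfolding col_def using k_commute[of u v] by blast

lemma card_col: "v \<in> V \<Longrightarrow> card (col v) = card V - 1"
  by (simp add: col_def card_image k_inj_on finite_V)

lemma d_commute: "\<lbrakk>u \<in> V; v \<in> V\<rbrakk> \<Longrightarrow> d u v = d v u"
  using card_col[of u] card_col[of v]
  by (simp add: d_def card_Diff_subset_Int Int_commute)

lemma d_triangle: "d u w \<le> d u v + d v w"
proof -
  have "d u w \<le> card ((col u - col v) \<union> (col v - col w))"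
    unfolding d_def by (rule card_mono) auto
  also have "\<dots> \<le> d u v + d v w" unfolding d_def by (rule card_Un_le)
  finally show ?thesis .
qed

lemma card_colour_nbrs:
  assumes "u \<in> V"
  shows "card {v \<in> V - {u}. k u v \<in> C} = card (col u \<inter> C)"
proof -
  have "col u \<inter> C = k u ` {v \<in> V - {u}. k u v \<in> C}" by (auto simp: col_def)
  moreover have "inj_on (k u) {v \<in> V - {u}. k u v \<in> C}"
    by (rule inj_on_subset[OF k_inj_on[OF assms]]) auto
  ultimately show ?thesis by (simp add: card_image)
qed

lemma card_foreign_nbrs:
  assumes "u \<in> V"
  shows "card {v \<in> V - {u}. k u v \<notin> col i} = d u i"
  using card_colour_nbrs[OF assms, of "- col i"] by (simp add: d_def Diff_eq)

lemma pairs_Sigma: "pairs C = (SIGMA y:V. {z \<in> V - {y}. k y z \<in> C})"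
  by (auto simp: pairs_def)

lemma card_pairs: "card (pairs C) = (\<Sum>y\<in>V. card (col y \<inter> C))"
proof -
  have "card (pairs C) = (\<Sum>y\<in>V. card {z \<in> V - {y}. k y z \<in> C})"
    unfolding pairs_Sigma by (rule card_SigmaI) (auto simp: finite_V)
  also have "\<dots> = (\<Sum>y\<in>V. card (col y \<inter> C))"
    by (intro sum.cong refl card_colour_nbrs)
  finally show ?thesis .
qed

text \<open>Counting by first ends gives the sum of all \<open>d y i\<close>; the symmetry of
  \<open>d\<close> turns this into \<open>dsum i\<close>.\<close>

lemma card_pairs_foreign: "i \<in> V \<Longrightarrow> card (pairs (- col i)) = dsum i"
  unfolding card_pairs dsum_def
  by (intro sum.cong) (auto simp: d_commute[unfolded d_def, of i] d_def Diff_eq[symmetric])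

lemma card_pairs_le: "finite C \<Longrightarrow> card (pairs C) \<le> card V * card C"
  unfolding card_pairs
  using sum_bounded_above[of V "\<lambda>y. card (col y \<inter> C)" "card C"] by (simp add: card_mono)

text \<open>The triangle inequality, summed over all third vertices. It shows that two vertices with
  small \<open>dsum\<close> miss few of each other's colours.\<close>

lemma card_V_d_le:
  assumes "u \<in> V" "v \<in> V"
  shows "card V * d u v \<le> dsum u + dsum v"
proof -
  have "card V * d u v = (\<Sum>w\<in>V. d u v)" by simp
  also have "\<dots> \<le> (\<Sum>w\<in>V. d u w + d v w)"
    by (intro sum_mono) (metis assms d_commute d_triangle)
  finally show ?thesis by (simp add: dsum_def sum.distrib)
qed

text \<open>All distances are routed through \<open>v\<close>. Hence no \<open>dsum v\<close> lies
  below half the average, and only an upper bound has to be arranged when the roots are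
  chosen.\<close>

lemma sum_dsum_le:
  assumes "v \<in> V"
  shows "(\<Sum>u\<in>V. dsum u) \<le> 2 * card V * dsum v"
proof -
  have "(\<Sum>u\<in>V. dsum u) \<le> (\<Sum>u\<in>V. \<Sum>w\<in>V. d u v + d v w)"
    unfolding dsum_def by (intro sum_mono d_triangle)
  also have "\<dots> = card V * (\<Sum>u\<in>V. d u v) + card V * dsum v"
    by (simp add: sum.distrib dsum_def sum_distrib_left)
  also have "(\<Sum>u\<in>V. d u v) = dsum v"
    unfolding dsum_def by (intro sum.cong) (auto simp: d_commute assms)
  finally show ?thesis by simp
qed

text \<open>Each colour in \<open>col v \<inter> C\<close> is missing from at least half of the sets \<open>col w\<close>.\<close>

lemma sparse_colours_le:
  assumes v: "v \<in> V" and C: "\<And>c. c \<in> C \<Longrightarrow> 2 * card (pairs {c}) \<le> card V"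
  shows "card V * card (col v \<inter> C) \<le> 2 * dsum v"
proof -
  have "card V \<le> 2 * (\<Sum>w\<in>V. card ({c} - col w))" if "c \<in> C" for c
  proof -
    have "card ({c} - col w) + card (col w \<inter> {c}) = 1" for w
      by (cases "c \<in> col w") (simp_all add: insert_Diff_if)
    then have "(\<Sum>w\<in>V. card ({c} - col w)) + card (pairs {c}) = card V"
      unfolding card_pairs by (simp add: sum.distrib[symmetric])
    then show ?thesis using C[OF that] by linarith
  qed
  then have "card V * card (col v \<inter> C) \<le> (\<Sum>c\<in>col v \<inter> C. 2 * (\<Sum>w\<in>V. card ({c} - col w)))"
    using sum_bounded_below[of "col v \<inter> C" "card V" "\<lambda>c. 2 * (\<Sum>w\<in>V. card ({c} - col w))"]
    by (simp add: mult.commute)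
  also have "\<dots> = 2 * (\<Sum>w\<in>V. \<Sum>c\<in>col v \<inter> C. card ({c} - col w))"
    unfolding sum_distrib_left[symmetric] by (subst sum.swap) simp
  also have "\<dots> \<le> 2 * (\<Sum>w\<in>V. d v w)"
  proof (intro mult_le_mono2 sum_mono)
    fix w
    have "(\<Sum>c\<in>col v \<inter> C. card ({c} - col w)) = card ((col v \<inter> C) - col w)"
    proof -
      have "(\<Sum>c\<in>col v \<inter> C. card ({c} - col w)) = (\<Sum>c\<in>col v \<inter> C. if c \<in> col w then 0 else 1)"
        by (intro sum.cong) (auto simp: insert_Diff_if)
      also have "\<dots> = card ((col v \<inter> C) - col w)"
        by (simp add: sum.If_cases Diff_eq)
      finally show ?thesis .
    qed
    also have "\<dots> \<le> d v w" unfolding d_def by (rule card_mono) auto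
    finally show "(\<Sum>c\<in>col v \<inter> C. card ({c} - col w)) \<le> d v w" .
  qed
  finally show ?thesis by (simp add: dsum_def)
qed

end

section \<open>Packings of rooted trees\<close>

locale rooted_colouring = proper_colouring V k
  for V :: "'a set" and k :: "'a \<Rightarrow> 'a \<Rightarrow> 'c" +
  fixes R :: "'a set"
  assumes R_subset: "R \<subseteq> V"
begin

lemma finite_R [simp]: "finite R"
  using R_subset finite_V finite_subset by blast

definition cols :: "('a \<Rightarrow> 'a \<Rightarrow> 'a) \<Rightarrow> ('a \<Rightarrow> 'a set) \<Rightarrow> 'a \<Rightarrow> 'c set" where
  "cols p J i = (\<lambda>v. k v (p i v)) ` (V - R \<union> J i)"

definition edges :: "('a \<Rightarrow> 'a \<Rightarrow> 'a) \<Rightarrow> ('a \<Rightarrow> 'a set) \<Rightarrow> 'a \<Rightarrow> 'a set set" where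
  "edges p J i = (\<lambda>v. {v, p i v}) ` (V - R \<union> J i)"

text \<open>The edges \<open>{i, v}\<close> with \<open>v\<close> in this set are exactly those that
  the star at \<open>i\<close> has given up; other trees may use them to take in
  \<open>i\<close>.\<close>

definition moved :: "('a \<Rightarrow> 'a \<Rightarrow> 'a) \<Rightarrow> 'a \<Rightarrow> 'a set" where
  "moved p i = {v \<in> V - R. p i v \<noteq> i}"

text \<open>The rank excludes cycles. Apart from \<open>i\<close>, no root is a parent, so roots in
  \<open>J i\<close> are leaves and no edge between two roots is ever used.\<close>

definition wf_tree :: "('a \<Rightarrow> 'a \<Rightarrow> 'a) \<Rightarrow> ('a \<Rightarrow> 'a set) \<Rightarrow> 'a \<Rightarrow> bool" where
  "wf_tree p J i \<longleftrightarrow>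
     J i \<subseteq> R - {i} \<and>
     (\<forall>v\<in>V - R. p i v = i \<or> p i v \<in> V - R) \<and>
     (\<forall>j\<in>J i. p i j \<in> V - R) \<and>
     (\<exists>\<rho> :: 'a \<Rightarrow> nat. \<forall>v\<in>V - R \<union> J i. \<rho> (p i v) < \<rho> v) \<and>
     inj_on (\<lambda>v. k v (p i v)) (V - R \<union> J i)"

text \<open>The tree with root \<open>i\<close> is stored by its parent function \<open>p i\<close>; besides \<open>i\<close> it covers
  the vertices outside \<open>R\<close> and those roots that lie in \<open>J i\<close>.\<close>

definition packing :: "('a \<Rightarrow> 'a \<Rightarrow> 'a) \<Rightarrow> ('a \<Rightarrow> 'a set) \<Rightarrow> bool" where
  "packing p J \<longleftrightarrow>
     (\<forall>i\<in>R. wf_tree p J i) \<and>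
     (\<forall>i\<in>R. \<forall>i'\<in>R. i \<noteq> i' \<longrightarrow> edges p J i \<inter> edges p J i' = {})"

abbreviation reattach :: "('a \<Rightarrow> 'a \<Rightarrow> 'a) \<Rightarrow> 'a \<Rightarrow> 'a \<Rightarrow> 'a \<Rightarrow> 'a \<Rightarrow> 'a \<Rightarrow> 'a" where
  "reattach p i y z \<equiv> p(i := (p i)(y := z))"

lemma finite_moved [simp]: "finite (moved p i)"
  by (simp add: moved_def finite_V)

lemma packing_wf: "\<lbrakk>packing p J; i \<in> R\<rbrakk> \<Longrightarrow> wf_tree p J i"
  by (simp add: packing_def)

lemma J_subset: "\<lbrakk>packing p J; i \<in> R\<rbrakk> \<Longrightarrow> J i \<subseteq> R - {i}"
  by (simp add: packing_def wf_tree_def)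

lemma finite_J: "\<lbrakk>packing p J; i \<in> R\<rbrakk> \<Longrightarrow> finite (J i)"
  using J_subset finite_R by (meson finite_Diff finite_subset)

lemma reattach_other [simp]:
  assumes "i' \<noteq> i"
  shows "cols (reattach p i y z) J i' = cols p J i'"
    and "edges (reattach p i y z) J i' = edges p J i'"
    and "moved (reattach p i y z) i' = moved p i'"
    and "wf_tree (reattach p i y z) J i' = wf_tree p J i'"
  using assms by (auto simp: cols_def edges_def moved_def wf_tree_def)

lemma edges_cong_J: "J' i = J i \<Longrightarrow> edges p J' i = edges p J i"
  by (simp add: edges_def)

lemma wf_tree_cong_J: "J' i = J i \<Longrightarrow> wf_tree p J' i = wf_tree p J i"
  by (simp add: wf_tree_def)

text \<open>As \<open>z\<close> is a child of \<open>i\<close>, it is not below \<open>y\<close>, so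
  no cycle arises whatever hangs below \<open>y\<close>.\<close>

lemma packing_reattach:
  assumes pack: "packing p J" and i: "i \<in> R"
    and y: "y \<in> V - R" and z: "z \<in> V - R" "z \<noteq> y" "p i z = i"
    and colour: "k y z \<notin> cols p J i"
    and edge: "\<And>i'. i' \<in> R - {i} \<Longrightarrow> {y, z} \<notin> edges p J i'"
  shows "packing (reattach p i y z) J"
    and "cols (reattach p i y z) J i = insert (k y z) (cols p J i - {k y (p i y)})"
    and "moved (reattach p i y z) i = insert y (moved p i)"
proof -
  let ?p = "reattach p i y z" and ?D = "V - R \<union> J i"
  have wf: "wf_tree p J i" using pack i by (rule packing_wf)
  then obtain \<rho> :: "'a \<Rightarrow> nat" where \<rho>: "\<And>v. v \<in> ?D \<Longrightarrow> \<rho> (p i v) < \<rho> v"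
    unfolding wf_tree_def by blast
  have inj: "inj_on (\<lambda>v. k v (p i v)) ?D" and Ji: "J i \<subseteq> R - {i}"
    using wf by (auto simp: wf_tree_def)
  have D: "?D = insert y (?D - {y})" using y by auto
  have minus: "(\<lambda>v. k v (p i v)) ` (?D - {y}) = cols p J i - {k y (p i y)}"
    using inj y by (auto simp: cols_def inj_on_def)
  show c: "cols ?p J i = insert (k y z) (cols p J i - {k y (p i y)})"
    unfolding minus[symmetric] by (subst (1) cols_def, subst D) auto
  show "moved ?p i = insert y (moved p i)"
    using y z i by (auto simp: moved_def)
  have WF: "wf_tree ?p J i"
    unfolding wf_tree_def
  proof (intro conjI)
    show "J i \<subseteq> R - {i}" by (rule Ji)
    show "\<forall>v\<in>V - R. ?p i v = i \<or> ?p i v \<in> V - R" using wf z by (auto simp: wf_tree_def)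
    show "\<forall>j\<in>J i. ?p i j \<in> V - R" using wf y Ji by (auto simp: wf_tree_def)
    \<comment> \<open>Ranks 0 and 1 are reserved for \<open>i\<close> and its child
      \<open>z\<close>; shifting all others by 2 puts \<open>z\<close> below \<open>y\<close> in
      rank.\<close>
    define \<rho>' where "\<rho>' v = (if v = i then 0 else if v = z then 1 else \<rho> v + 2)" for v
    have "\<rho>' (?p i v) < \<rho>' v" if "v \<in> ?D" for v
      using \<rho>[OF that] that z i Ji by (auto simp: \<rho>'_def)
    then show "\<exists>\<rho> :: 'a \<Rightarrow> nat. \<forall>v\<in>?D. \<rho> (?p i v) < \<rho> v" by blast
    have "inj_on (\<lambda>v. k v (?p i v)) (?D - {y})"
      using inj by (auto simp: inj_on_def)
    moreover have "(\<lambda>v. k v (?p i v)) ` (?D - {y}) = cols p J i - {k y (p i y)}"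
      unfolding minus[symmetric] by (rule image_cong) auto
    ultimately have "inj_on (\<lambda>v. k v (?p i v)) (insert y (?D - {y}))"
      unfolding inj_on_insert using colour by simp
    then show "inj_on (\<lambda>v. k v (?p i v)) ?D" by (rule inj_on_subset) auto
  qed
  have "edges ?p J i \<subseteq> insert {y, z} (edges p J i)"
    by (auto simp: edges_def)
  then have DIS: "edges ?p J i \<inter> edges p J i' = {}" if "i' \<in> R - {i}" for i'
  proof -
    have "edges p J i \<inter> edges p J i' = {}" using that pack i by (auto simp: packing_def)
    moreover have "{y, z} \<notin> edges p J i'" by (rule edge[OF that])
    ultimately show ?thesis using \<open>edges ?p J i \<subseteq> insert {y, z} (edges p J i)\<close> by blast
  qed
  show "packing ?p J"
    unfolding packing_def
  proof (intro conjI ballI impI)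
    fix a assume "a \<in> R"
    then show "wf_tree ?p J a"
      using WF pack i by (cases "a = i") (auto simp: packing_def)
  next
    fix a b assume "a \<in> R" "b \<in> R" "a \<noteq> b"
    moreover have "edges p J a \<inter> edges p J b = {}"
      using calculation pack by (simp add: packing_def)
    ultimately show "edges ?p J a \<inter> edges ?p J b = {}"
      using DIS[of a] DIS[of b] by (cases "a = i"; cases "b = i") (simp_all add: Int_commute)
  qed
qed

text \<open>A new leaf \<open>j\<close> below \<open>x\<close> cannot close a cycle, and nothing is
  removed from the tree.\<close>

lemma packing_add_root:
  assumes pack: "packing p J" and i: "i \<in> R"
    and j: "j \<in> R - {i}" "j \<notin> J i" and x: "x \<in> V - R"
    and colour: "k j x \<notin> cols p J i"
    and edge: "\<And>i'. i' \<in> R - {i} \<Longrightarrow> {j, x} \<notin> edges p J i'"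
  defines "p' \<equiv> reattach p i j x" and "J' \<equiv> J(i := insert j (J i))"
  shows "packing p' J'" and "cols p' J' i = insert (k j x) (cols p J i)"
    and "moved p' i = moved p i"
proof -
  let ?D = "V - R \<union> J i"
  have wf: "wf_tree p J i" using pack i by (rule packing_wf)
  then obtain \<rho> :: "'a \<Rightarrow> nat" where \<rho>: "\<And>v. v \<in> ?D \<Longrightarrow> \<rho> (p i v) < \<rho> v"
    unfolding wf_tree_def by blast
  have inj: "inj_on (\<lambda>v. k v (p i v)) ?D" and Ji: "J i \<subseteq> R - {i}"
    using wf by (auto simp: wf_tree_def)
  have D: "V - R \<union> J' i = insert j ?D" and jD: "j \<notin> ?D" using j by (auto simp: J'_def)
  have img: "(\<lambda>v. k v (p' i v)) ` ?D = cols p J i"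
    unfolding cols_def by (rule image_cong) (use jD in \<open>auto simp: p'_def\<close>)
  show "cols p' J' i = insert (k j x) (cols p J i)"
    unfolding img[symmetric] by (subst cols_def, subst D) (simp add: p'_def)
  show "moved p' i = moved p i" using j by (auto simp: moved_def p'_def)
  have WF: "wf_tree p' J' i"
    unfolding wf_tree_def
  proof (intro conjI)
    show "J' i \<subseteq> R - {i}" using Ji j by (auto simp: J'_def)
    show "\<forall>v\<in>V - R. p' i v = i \<or> p' i v \<in> V - R"
      using wf j by (auto simp: wf_tree_def p'_def)
    show "\<forall>j\<in>J' i. p' i j \<in> V - R" using wf x by (auto simp: wf_tree_def J'_def p'_def)
    \<comment> \<open>As \<open>j\<close> is nobody's parent, its rank can be reset freely to one
      above that of \<open>x\<close>.\<close>
    have "p i v \<noteq> j" if "v \<in> ?D" for v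
      using that wf j by (auto simp: wf_tree_def)
    then have "(\<rho>(j := Suc (\<rho> x))) (p' i v) < (\<rho>(j := Suc (\<rho> x))) v"
      if "v \<in> V - R \<union> J' i" for v
      using \<rho>[of v] that jD j x unfolding D p'_def by auto
    then show "\<exists>\<rho> :: 'a \<Rightarrow> nat. \<forall>v\<in>V - R \<union> J' i. \<rho> (p' i v) < \<rho> v" by blast
    have "inj_on (\<lambda>v. k v (p' i v)) ?D"
      using inj jD by (auto simp: inj_on_def p'_def)
    then show "inj_on (\<lambda>v. k v (p' i v)) (V - R \<union> J' i)"
      unfolding D using colour jD by (simp add: img) (simp add: p'_def)
  qed
  have "edges p' J' i \<subseteq> insert {j, x} (edges p J i)"
    by (auto simp: edges_def p'_def J'_def)
  then have DIS: "edges p' J' i \<inter> edges p J i' = {}" if "i' \<in> R - {i}" for i'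
  proof -
    have "edges p J i \<inter> edges p J i' = {}" using that pack i by (auto simp: packing_def)
    moreover have "{j, x} \<notin> edges p J i'" by (rule edge[OF that])
    ultimately show ?thesis using \<open>edges p' J' i \<subseteq> insert {j, x} (edges p J i)\<close> by blast
  qed
  have OTH: "edges p' J' i' = edges p J i'" "wf_tree p' J' i' = wf_tree p J i'" if "i' \<noteq> i" for i'
    using that edges_cong_J[of J' i' J p'] wf_tree_cong_J[of J' i' J p']
    by (simp_all add: p'_def J'_def)
  show "packing p' J'"
    unfolding packing_def
  proof (intro conjI ballI impI)
    fix a assume "a \<in> R"
    then show "wf_tree p' J' a"
      using WF packing_wf[OF pack] OTH(2)[of a] by (cases "a = i") simp_all
  next
    fix a b assume "a \<in> R" "b \<in> R" "a \<noteq> b"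
    moreover have "edges p J a \<inter> edges p J b = {}"
      using calculation pack by (simp add: packing_def)
    ultimately show "edges p' J' a \<inter> edges p' J' b = {}"
      using DIS[of a] DIS[of b] OTH(1)[of a] OTH(1)[of b] by (cases "a = i"; cases "b = i") (simp_all add: Int_commute)
  qed
qed

lemma packing_stars: "packing (\<lambda>i v. i) (\<lambda>_. {})"
proof -
  have "wf_tree (\<lambda>i v. i) (\<lambda>_. {}) i" if i: "i \<in> R" for i
    unfolding wf_tree_def
  proof (intro conjI)
    show "\<exists>\<rho> :: 'a \<Rightarrow> nat. \<forall>v\<in>V - R \<union> {}. \<rho> i < \<rho> v"
      using i by (intro exI[of _ "\<lambda>v. if v = i then 0 else 1"]) auto
    have "inj_on (k i) (V - R)"
      by (rule inj_on_subset[OF k_inj_on]) (use i R_subset in auto)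
    then show "inj_on (\<lambda>v. k v i) (V - R \<union> {})" by (simp add: k_commute[of _ i])
  qed auto
  moreover have "edges (\<lambda>i v. i) (\<lambda>_. {}) i \<inter> edges (\<lambda>i v. i) (\<lambda>_. {}) i' = {}"
    if "i \<in> R" "i' \<in> R" "i \<noteq> i'" for i i'
    using that by (auto simp: edges_def doubleton_eq_iff)
  ultimately show ?thesis by (auto simp: packing_def)
qed

text \<open>Children of \<open>i\<close> outside \<open>R\<close> use colours of
  \<open>col i\<close> only. A foreign colour is therefore blocked only by the few vertices in
  \<open>moved p i\<close> and \<open>J i\<close>.\<close>

lemma cols_subset:
  assumes "packing p J" "i \<in> R"
  shows "cols p J i \<subseteq> col i \<union> (\<lambda>v. k v (p i v)) ` (moved p i \<union> J i)"
proof
  fix c assume "c \<in> cols p J i"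
  then obtain v where v: "v \<in> V - R \<union> J i" "c = k v (p i v)" by (auto simp: cols_def)
  show "c \<in> col i \<union> (\<lambda>v. k v (p i v)) ` (moved p i \<union> J i)"
  proof (cases "v \<in> V - R \<and> p i v = i")
    case True
    then show ?thesis using v assms R_subset k_in_col[of v i] by auto
  next
    case False
    then show ?thesis using v by (auto simp: moved_def)
  qed
qed

text \<open>The edges inside \<open>V - R\<close> that are in use, in both orientations.\<close>

definition used :: "('a \<Rightarrow> 'a \<Rightarrow> 'a) \<Rightarrow> ('a \<times> 'a) set" where
  "used p = (\<Union>i\<in>R. \<Union>v\<in>moved p i. {(v, p i v), (p i v, v)})"

lemma finite_used [simp]: "finite (used p)"
  by (simp add: used_def)

lemma used_commute: "(y, z) \<in> used p \<longleftrightarrow> (z, y) \<in> used p"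
  by (auto simp: used_def)

lemma card_used_le:
  assumes "\<And>i. i \<in> R \<Longrightarrow> card (moved p i) \<le> a"
  shows "card (used p) \<le> card R * (2 * a)"
proof -
  have "card (\<Union>v\<in>moved p i. {(v, p i v), (p i v, v)}) \<le> 2 * a" if "i \<in> R" for i
  proof -
    have "card (\<Union>v\<in>moved p i. {(v, p i v), (p i v, v)})
        \<le> (\<Sum>v\<in>moved p i. card {(v, p i v), (p i v, v)})"
      by (rule card_UN_le) simp
    also have "\<dots> \<le> (\<Sum>v\<in>moved p i. 2)"
      by (intro sum_mono) (simp add: card_insert_if)
    finally show ?thesis using assms[OF that] by simp
  qed
  then have "(\<Sum>i\<in>R. card (\<Union>v\<in>moved p i. {(v, p i v), (p i v, v)})) \<le> (\<Sum>i\<in>R. 2 * a)"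
    by (rule sum_mono)
  then show ?thesis
    using card_UN_le[of R "\<lambda>i. \<Union>v\<in>moved p i. {(v, p i v), (p i v, v)}"]
    by (simp add: used_def)
qed

text \<open>Each rainbow tree uses a colour at most once, and \<open>used\<close> holds both
  orientations of the edge.\<close>

lemma card_used_colour_le:
  assumes "packing p J"
  shows "card (used p \<inter> {(y, z). k y z = c}) \<le> card R * 2"
proof -
  let ?S = "\<lambda>i. \<Union>v\<in>{v \<in> moved p i. k v (p i v) = c}. {(v, p i v), (p i v, v)}"
  have "card (?S i) \<le> 2" if "i \<in> R" for i
  proof -
    have "inj_on (\<lambda>v. k v (p i v)) (moved p i)"
      by (rule inj_on_subset[of _ "V - R \<union> J i"])
        (use packing_wf[OF assms that] in \<open>auto simp: wf_tree_def moved_def\<close>)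
    then have one: "card {v \<in> moved p i. k v (p i v) = c} \<le> 1"
      by (intro card_le_Suc0_iff_eq[THEN iffD2, folded One_nat_def]) (auto simp: inj_on_def)
    have "card (?S i) \<le> (\<Sum>v\<in>{v \<in> moved p i. k v (p i v) = c}. card {(v, p i v), (p i v, v)})"
      by (rule card_UN_le) simp
    also have "\<dots> \<le> (\<Sum>v\<in>{v \<in> moved p i. k v (p i v) = c}. 2)"
      by (intro sum_mono) (simp add: card_insert_if)
    finally show ?thesis using one by simp
  qed
  then have "(\<Sum>i\<in>R. card (?S i)) \<le> (\<Sum>i\<in>R. 2)" by (rule sum_mono)
  moreover have "used p \<inter> {(y, z). k y z = c} \<subseteq> (\<Union>i\<in>R. ?S i)"
  proof clarify
    fix y z assume "(y, z) \<in> used p" and c: "c = k y z"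
    then obtain i v where v: "i \<in> R" "v \<in> moved p i"
      and yz: "(y, z) = (v, p i v) \<or> (y, z) = (p i v, v)"
      unfolding used_def by blast
    then have "k v (p i v) = k y z" using k_commute[of y z] by auto
    then show "(y, z) \<in> (\<Union>i\<in>R. \<Union>v\<in>{v \<in> moved p i. k v (p i v) = k y z}. {(v, p i v), (p i v, v)})"
      using v yz by blast
  qed
  then have "card (used p \<inter> {(y, z). k y z = c}) \<le> card (\<Union>i\<in>R. ?S i)"
    by (intro card_mono) auto
  ultimately show ?thesis
    using card_UN_le[of R ?S] by simp
qed

text \<open>An edge inside \<open>V - R\<close> can belong to a tree only through a moved vertex.
  Avoiding \<open>used\<close> thus yields the disjointness condition of
  \<open>packing_reattach\<close>.\<close>

lemma not_used_edge:
  assumes pack: "packing p J" and i: "i \<in> R" and yz: "y \<in> V - R" "z \<in> V - R" "(y, z) \<notin> used p"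
  shows "{y, z} \<notin> edges p J i"
proof
  assume "{y, z} \<in> edges p J i"
  then obtain v where v: "v \<in> V - R \<union> J i" "{y, z} = {v, p i v}" by (auto simp: edges_def)
  then have "v \<in> V - R" "p i v \<noteq> i" using yz J_subset[OF pack i] i by (auto simp: doubleton_eq_iff)
  then have "v \<in> moved p i" by (simp add: moved_def)
  then show False using v i yz(3) by (auto simp: used_def doubleton_eq_iff)
qed

end

text \<open>Double counting: the pairs in \<open>P\<close> have at least \<open>card P / q\<close>
  different first entries. Applied to admissible oriented edges, it gives many vertices
  \<open>y\<close> that can be moved, each with a new parent \<open>g y\<close>.\<close>

lemma exists_many_fibres:
  fixes b :: real
  assumes "finite P" and "\<And>y. card (P `` {y}) \<le> q" and "q > 0" and "real q * b \<le> real (card P)"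
  obtains Y g where "finite Y" "b \<le> real (card Y)" "\<And>y. y \<in> Y \<Longrightarrow> (y, g y) \<in> P"
proof
  show "finite (fst ` P)" using assms by simp
  have fin: "finite (P `` {y})" for y
    using finite_imageI[OF assms(1), of snd] by (rule rev_finite_subset) force
  have "P = (SIGMA y:fst ` P. P `` {y})" by force
  then have "card P = card (SIGMA y:fst ` P. P `` {y})" by (rule arg_cong)
  also have "\<dots> = (\<Sum>y\<in>fst ` P. card (P `` {y}))"
    using assms(1) fin by (intro card_SigmaI) auto
  also have "\<dots> \<le> card (fst ` P) * q"
    using sum_bounded_above[of "fst ` P" "\<lambda>y. card (P `` {y})" q] assms(2) by simp
  finally have "real (card P) \<le> real q * real (card (fst ` P))"
    by (simp add: mult.commute flip: of_nat_mult)
  then have "real q * b \<le> real q * real (card (fst ` P))"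
    using assms(4) by linarith
  then show "b \<le> real (card (fst ` P))" using assms(3) by simp
  show "(y, SOME z. (y, z) \<in> P) \<in> P" if "y \<in> fst ` P" for y
    using that by (auto intro: someI)
qed

section \<open>Counting coloured pairs near a vertex or a set of vertices\<close>

context proper_colouring
begin

lemma pairs_commute: "(y, z) \<in> pairs C \<longleftrightarrow> (z, y) \<in> pairs C"
  by (auto simp: pairs_def k_commute[of y z])

lemma card_pairs_fibre: "card (pairs C `` {y}) \<le> card (col y \<inter> C)"
proof (cases "y \<in> V")
  case True
  have "pairs C `` {y} = {z \<in> V - {y}. k y z \<in> C}" using True by (auto simp: pairs_def)
  then show ?thesis using card_colour_nbrs[OF True] by simp
next
  case False
  then have "pairs C `` {y} = {}" by (auto simp: pairs_def)
  then show ?thesis by simp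
qed

text \<open>Pairs that start in \<open>Z\<close> are counted fibre by fibre; those that end in
  \<open>Z\<close> are their swaps, whence the factor 2.\<close>

lemma card_pairs_meeting:
  assumes "finite Z"
  shows "card (pairs C \<inter> {(y, z). y \<in> Z \<or> z \<in> Z}) \<le> 2 * (\<Sum>y\<in>Z. card (col y \<inter> C))"
proof -
  define A where "A = (SIGMA y:Z. pairs C `` {y})"
  have fin: "finite (pairs C `` {y})" for y
    using finite_imageI[OF finite_pairs, of snd C] by (rule rev_finite_subset) force
  have A: "finite A" using assms fin by (auto simp: A_def)
  have "card A \<le> (\<Sum>y\<in>Z. card (col y \<inter> C))"
    unfolding A_def using assms fin
    by (subst card_SigmaI) (auto intro: sum_mono card_pairs_fibre)
  moreover have "pairs C \<inter> {(y, z). y \<in> Z \<or> z \<in> Z} \<subseteq> A \<union> prod.swap ` A"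
    using pairs_commute by (force simp: A_def)
  then have "card (pairs C \<inter> {(y, z). y \<in> Z \<or> z \<in> Z}) \<le> card (A \<union> prod.swap ` A)"
    using A by (intro card_mono) auto
  moreover have "card (A \<union> prod.swap ` A) \<le> card A + card A"
    using card_Un_le[of A "prod.swap ` A"] card_image_le[OF A, of prod.swap] by linarith
  ultimately show ?thesis by linarith
qed

lemma card_col_Int_le: "card (col v \<inter> C) \<le> card V"
proof -
  have "card (col v \<inter> C) \<le> card (col v)" by (rule card_mono) auto
  also have "\<dots> \<le> card (V - {v})" unfolding col_def by (rule card_image_le) (simp add: finite_V)
  also have "\<dots> \<le> card V" by (rule card_mono) (auto simp: finite_V)
  finally show ?thesis .
qed

lemma card_same_colour:
  assumes "i \<in> V"
  shows "card {v \<in> V - {i}. k i v = c} \<le> 1"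
proof -
  have "card (col i \<inter> {c}) \<le> card {c}" by (rule card_mono) auto
  then show ?thesis using card_colour_nbrs[OF assms, of "{c}"] by simp
qed

end

section \<open>Free colours\<close>

text \<open>\<open>exists_root_system\<close> takes for \<open>\<Delta>\<close> the average of
  \<open>dsum\<close> over \<open>V\<close>. The last assumption bounds the rare colours on edges
  from \<open>i\<close> to other roots, that is, the initially free colours that need
  replacing.\<close>

locale root_system = rooted_colouring V k R
  for V :: "'a set" and k :: "'a \<Rightarrow> 'a \<Rightarrow> 'c" and R :: "'a set" +
  fixes \<Delta> :: real
  assumes R_small: "4 * 10 ^ 11 * real (card R) \<le> real (card V)"
    and R_nonempty: "R \<noteq> {}"
    and dsum_lower: "i \<in> R \<Longrightarrow> \<Delta> / 2 \<le> real (dsum i)"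
    and dsum_upper: "i \<in> R \<Longrightarrow> real (dsum i) \<le> 2 * \<Delta>"
    and sparse_in_R: "i \<in> R \<Longrightarrow>
      real (card {j \<in> R - {i}. 100 * card (pairs {k i j}) < card V}) * real (card V) ^ 2
        \<le> 16 * real (card R) * \<Delta>"
begin

text \<open>In the rich case foreign colours alone provide enough free colours, so that \<open>common\<close> and
  \<open>slack\<close> impose no condition.\<close>

definition rich :: bool where
  "rich \<longleftrightarrow> real (card V) ^ 2 / 10 ^ 4 < \<Delta>"

definition common :: "'c \<Rightarrow> bool" where
  "common c \<longleftrightarrow> rich \<or> card V \<le> 100 * card (pairs {c})"

text \<open>As \<open>k i\<close> is injective on \<open>V - {i}\<close>, this counts the common
  colours at \<open>i\<close> outside \<open>C\<close>.\<close>

definition nfree :: "'a \<Rightarrow> 'c set \<Rightarrow> nat" where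
  "nfree i C = card {v \<in> V - {i}. common (k i v) \<and> k i v \<notin> C}"

text \<open>The tree still has to take in \<open>card R - 1 - card (J i)\<close> roots, and each
  costs at most one free colour. In particular, a common colour is free as long as a root is
  missing.\<close>

definition slack :: "('a \<Rightarrow> 'a \<Rightarrow> 'a) \<Rightarrow> ('a \<Rightarrow> 'a set) \<Rightarrow> 'a \<Rightarrow> bool" where
  "slack p J i \<longleftrightarrow> rich \<or> card R - 1 \<le> nfree i (cols p J i) + card (J i)"

lemma card_R_pos: "0 < card R"
  using R_nonempty by (simp add: card_gt_0_iff)

lemma card_V_pos: "0 < card V"
  using R_small card_R_pos by (cases "card V = 0") auto

lemma nfree_insert:
  assumes "i \<in> V"
  shows "nfree i C \<le> nfree i (insert c C) + 1"
proof -
  let ?A = "{v \<in> V - {i}. common (k i v) \<and> k i v \<notin> insert c C}"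
  let ?B = "{v \<in> V - {i}. k i v = c}"
  have "nfree i C \<le> card (?A \<union> ?B)"
    unfolding nfree_def by (rule card_mono) (auto simp: finite_V)
  also have "\<dots> \<le> card ?A + card ?B" by (rule card_Un_le)
  finally show ?thesis using card_same_colour[OF assms, of c] by (simp add: nfree_def)
qed

lemma nfree_insert_foreign:
  assumes "i \<in> V" and "c \<notin> col i"
  shows "nfree i (insert c C) = nfree i C"
proof -
  have "k i v \<noteq> c" if "v \<in> V - {i}" for v using that assms by (auto simp: col_def)
  then have "{v \<in> V - {i}. common (k i v) \<and> k i v \<notin> insert c C}
      = {v \<in> V - {i}. common (k i v) \<and> k i v \<notin> C}" by blast
  then show ?thesis by (simp add: nfree_def)
qed

lemma nfree_remove:
  assumes "i \<in> V" "y \<in> V - {i}" "common (k i y)" "k i y \<in> C"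
  shows "nfree i (C - {k i y}) = Suc (nfree i C)"
proof -
  have "{v \<in> V - {i}. common (k i v) \<and> k i v \<notin> C - {k i y}}
      = insert y {v \<in> V - {i}. common (k i v) \<and> k i v \<notin> C}"
    using assms k_inj[of i _ y] by auto
  then show ?thesis using assms by (simp add: nfree_def finite_V)
qed

text \<open>An uncommon colour is seen by less than a hundredth of the vertices, so
  \<open>sparse_colours_le\<close> applies; \<open>dsum_upper\<close> contributes the other factor
  2.\<close>

lemma card_uncommon_poor:
  assumes i: "i \<in> R" and poor: "\<not> rich"
  shows "real (card V) * real (card {v \<in> V - {i}. \<not> common (k i v)}) \<le> 4 * \<Delta>"
proof -
  have iV: "i \<in> V" using i R_subset by auto
  have H: "card V * card (col i \<inter> {c. \<not> common c}) \<le> 2 * dsum i"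
    by (rule sparse_colours_le[OF iV]) (auto simp: common_def)
  then show ?thesis
    using card_colour_nbrs[OF iV, of "{c. \<not> common c}"] of_nat_mono[where ?'a = real, OF H]
      dsum_upper[OF i] by simp
qed

lemma card_uncommon:
  assumes i: "i \<in> R"
  shows "real (card {v \<in> V - {i}. \<not> common (k i v)}) \<le> 4 * real (card V) / 10 ^ 4"
proof (cases rich)
  case True
  then show ?thesis by (simp add: common_def)
next
  case False
  let ?n = "real (card V)"
  have "?n * real (card {v \<in> V - {i}. \<not> common (k i v)}) \<le> 4 * \<Delta>"
    by (rule card_uncommon_poor[OF i False])
  also have "\<dots> \<le> ?n * (4 * ?n / 10 ^ 4)"
    using False by (simp add: rich_def power2_eq_square)
  finally show ?thesis using card_V_pos by (simp del: mult_le_cancel_left_pos add: mult_le_cancel_left)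
qed

text \<open>Linearly many moves that hang \<open>y\<close> below \<open>g y\<close>, avoiding a
  given set \<open>Z\<close>. In the poor case all use one free common colour, whose class is large;
  in the rich case they use foreign colours, of which there are quadratically many pairs.\<close>

lemma pool:
  assumes pack: "packing p J" and i: "i \<in> R"
    and size: "\<And>i'. i' \<in> R \<Longrightarrow> card (moved p i') \<le> 7 * card R"
    and slack: "slack p J i" and J: "card (J i) < card R - 1"
    and Z: "finite Z" "real (card Z) \<le> real (card V) / (2 * 10 ^ 5)"
  obtains Y g where "finite Y" and "real (card V) / 10 ^ 5 \<le> real (card Y)"
    and "\<And>y. y \<in> Y \<Longrightarrow> y \<in> V - R \<and> p i y = i \<and> y \<notin> Z \<and> common (k i y)"
    and "\<And>y. y \<in> Y \<Longrightarrow> g y \<in> V - R \<and> p i (g y) = i \<and> g y \<notin> Z \<and> g y \<noteq> y"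
    and "\<And>y. y \<in> Y \<Longrightarrow> k y (g y) \<notin> cols p J i \<and> (y, g y) \<notin> used p"
proof -
  let ?n = "real (card V)" and ?m = "real (card R)"
  define Q where "Q = {v \<in> V - {i}. \<not> common (k i v)}"
  \<comment> \<open>Besides \<open>Z\<close>, both ends must avoid roots and moved vertices, so as
    to be children of \<open>i\<close>. Avoiding \<open>Q\<close> ensures that the colour freed by a
    move is common.\<close>
  define Z' where "Z' = Z \<union> R \<union> moved p i \<union> Q"
  have iV: "i \<in> V" using i R_subset by auto
  have finZ': "finite Z'" using Z by (simp add: Z'_def Q_def finite_V)
  have "card Z' \<le> card Z + card R + card (moved p i) + card Q"
    unfolding Z'_def using card_Un_le[of "Z \<union> R \<union> moved p i" Q] card_Un_le[of "Z \<union> R" "moved p i"]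
      card_Un_le[of Z R] by linarith
  then have cardZ': "real (card Z') \<le> 4 * ?n / 10 ^ 4 + ?n / (2 * 10 ^ 5) + 8 * ?m"
    using Z(2) card_uncommon[OF i] size[OF i] unfolding Q_def by linarith
  have small: "4 * 10 ^ 11 * ?m \<le> ?n" by (rule R_small)
  define F where "F = (\<lambda>v. k v (p i v)) ` (moved p i \<union> J i)"
  have finJ: "finite (J i)" using finite_J pack i by blast
  have F: "finite F" "card F \<le> 8 * card R"
  proof -
    show "finite F" using finJ by (simp add: F_def)
    have "card F \<le> card (moved p i \<union> J i)"
      unfolding F_def by (rule card_image_le) (use finJ in simp)
    also have "\<dots> \<le> card (moved p i) + card (J i)" by (rule card_Un_le)
    finally show "card F \<le> 8 * card R" using size[OF i] J by linarith
  qed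
  define bad where "bad = {(y, z). y \<in> Z' \<or> z \<in> Z'}"
  \<comment> \<open>Both cases are reduced to the hypotheses of \<open>exists_many_fibres\<close>:
    \<open>q\<close> is 1 for a single colour and \<open>card V\<close> for foreign colours.\<close>
  obtain C q where C: "C \<inter> cols p J i = {}" and q: "q > 0" "\<And>y. card (pairs C `` {y}) \<le> q"
    and big: "real q * (?n / 10 ^ 5) \<le> real (card (pairs C - bad - used p))"
  proof (cases rich)
    case False
    then have "nfree i (cols p J i) > 0" using slack J by (simp add: slack_def)
    then have "{v \<in> V - {i}. common (k i v) \<and> k i v \<notin> cols p J i} \<noteq> {}"
      unfolding nfree_def by (metis card.empty less_irrefl)
    then obtain c where c: "common c" "c \<notin> cols p J i" by blast
    show ?thesis
    proof (rule that)
      show "{c} \<inter> cols p J i = {}" using c by simp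
      show "(1::nat) > 0" by simp
      have one: "card (col y \<inter> {c}) \<le> 1" for y
        using card_mono[of "{c}" "col y \<inter> {c}"] by simp
      show "card (pairs {c} `` {y}) \<le> 1" for y
        using card_pairs_fibre[of "{c}" y] one[of y] by linarith
      have "(\<Sum>y\<in>Z'. card (col y \<inter> {c})) \<le> card Z'"
        using sum_bounded_above[of Z' "\<lambda>y. card (col y \<inter> {c})" 1] one by simp
      then have "card (pairs {c} \<inter> bad) \<le> 2 * card Z'"
        using card_pairs_meeting[OF finZ', of "{c}"] by (simp add: bad_def)
      moreover have "card (pairs {c} \<inter> used p) \<le> card R * 2"
        using card_used_colour_le[OF pack, of c]
          card_mono[of "used p \<inter> {(y, z). k y z = c}" "pairs {c} \<inter> used p"]
        by (fastforce simp: pairs_def)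
      moreover have "card (pairs {c}) \<le> card (pairs {c} - bad - used p)
          + card (pairs {c} \<inter> bad) + card (pairs {c} \<inter> used p)"
      proof -
        have "card (pairs {c}) \<le> card ((pairs {c} - bad - used p) \<union> (pairs {c} \<inter> bad) \<union> (pairs {c} \<inter> used p))"
          by (rule card_mono) auto
        then show ?thesis
          using card_Un_le[of "pairs {c} - bad - used p \<union> pairs {c} \<inter> bad" "pairs {c} \<inter> used p"]
            card_Un_le[of "pairs {c} - bad - used p" "pairs {c} \<inter> bad"] by linarith
      qed
      \<comment> \<open>In units of \<open>?n / 10^5\<close>, colour \<open>c\<close> has at least
        1000 pairs, of which \<open>bad\<close> blocks little more than 81 and \<open>used\<close> a
        negligible number.\<close>
      moreover have "card V \<le> 100 * card (pairs {c})" using c False by (simp add: common_def)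
      ultimately show "real 1 * (?n / 10 ^ 5) \<le> real (card (pairs {c} - bad - used p))"
        using cardZ' small by simp
    qed
  next
    case True
    show ?thesis
    proof (rule that)
      let ?C = "- col i - F"
      show "?C \<inter> cols p J i = {}" using cols_subset[OF pack i] by (auto simp: F_def)
      show "card V > 0" by (rule card_V_pos)
      show "card (pairs ?C `` {y}) \<le> card V" for y
        using card_pairs_fibre[of ?C y] card_col_Int_le[of y ?C] by linarith
      have "(\<Sum>y\<in>Z'. card (col y \<inter> ?C)) \<le> card Z' * card V"
        using sum_bounded_above[of Z' "\<lambda>y. card (col y \<inter> ?C)" "card V"] card_col_Int_le by simp
      then have "card (pairs ?C \<inter> bad) \<le> 2 * (card Z' * card V)"
        using card_pairs_meeting[OF finZ', of ?C] by (simp add: bad_def)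
      then have b: "real (card (pairs ?C \<inter> bad)) \<le> 2 * (real (card Z') * ?n)"
        using of_nat_mono[where ?'a = real, OF \<open>card (pairs ?C \<inter> bad) \<le> 2 * (card Z' * card V)\<close>] by simp
      have "Q = {}" using True by (simp add: Q_def common_def)
      then have "card Z' \<le> card Z + card R + card (moved p i)"
        unfolding Z'_def using card_Un_le[of "Z \<union> R" "moved p i"] card_Un_le[of Z R] by simp
      then have "real (card Z') \<le> ?n / (2 * 10 ^ 5) + 8 * ?m"
        using Z(2) size[OF i] by linarith
      then have "real (card Z') * ?n \<le> (?n / (2 * 10 ^ 5) + 8 * ?m) * ?n"
        by (rule mult_right_mono) simp
      moreover have mn: "?m * ?n \<le> ?n * ?n / (4 * 10 ^ 11)"
        using mult_right_mono[OF small, of ?n] by simp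
      ultimately have b': "real (card (pairs ?C \<inter> bad)) \<le> 2 * (?n * ?n) / 10 ^ 5 * (6 / 10)"
        using b by (simp add: algebra_simps)
      have "card (pairs F) \<le> card V * (8 * card R)"
        using card_pairs_le[OF F(1)] F(2) by (meson mult_le_mono2 order_trans)
      then have f: "real (card (pairs F)) \<le> 8 * (?m * ?n)"
        using of_nat_mono[where ?'a = real, OF \<open>card (pairs F) \<le> card V * (8 * card R)\<close>]
        by (simp add: mult_ac)
      have "card (used p) \<le> card R * (2 * (7 * card R))"
        by (rule card_used_le) (rule size)
      then have "real (card (used p)) \<le> 14 * (?m * ?m)"
        using of_nat_mono[where ?'a = real, OF \<open>card (used p) \<le> card R * (2 * (7 * card R))\<close>] by simp
      also have "\<dots> \<le> 14 * (?m * ?n)"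
        using small by (intro mult_left_mono) auto
      finally have u: "real (card (used p)) \<le> 14 * (?m * ?n)" .
      have "card (pairs (- col i)) \<le> card ((pairs ?C - bad - used p) \<union> pairs F \<union> (pairs ?C \<inter> bad) \<union> used p)"
      proof (rule card_mono)
        show "pairs (- col i) \<subseteq> (pairs ?C - bad - used p) \<union> pairs F \<union> (pairs ?C \<inter> bad) \<union> used p"
          by (auto simp: pairs_def)
      qed simp
      also have "\<dots> \<le> card (pairs ?C - bad - used p) + card (pairs F) + card (pairs ?C \<inter> bad) + card (used p)"
        using card_Un_le[of "pairs ?C - bad - used p \<union> pairs F \<union> pairs ?C \<inter> bad" "used p"]
          card_Un_le[of "pairs ?C - bad - used p \<union> pairs F" "pairs ?C \<inter> bad"]
          card_Un_le[of "pairs ?C - bad - used p" "pairs F"] by linarith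
      finally have "real (dsum i) \<le> real (card (pairs ?C - bad - used p)) + real (card (pairs F))
          + real (card (pairs ?C \<inter> bad)) + real (card (used p))"
        unfolding card_pairs_foreign[OF iV] by linarith
      \<comment> \<open>In units of \<open>?n * ?n / 10^5\<close>, there are more than 5 foreign
        pairs; \<open>bad\<close> blocks at most 1.2, while \<open>F\<close> and \<open>used\<close>
        block a negligible number. One unit is needed.\<close>
      moreover have "real (dsum i) > ?n * ?n / 10 ^ 4 / 2"
        using dsum_lower[OF i] True by (simp add: rich_def power2_eq_square)
      ultimately show "?n * (?n / 10 ^ 5) \<le> real (card (pairs ?C - bad - used p))"
        using f u b' mn by simp
    qed
  qed
  have fin: "finite (pairs C - bad - used p)" by simp
  have fib: "card ((pairs C - bad - used p) `` {y}) \<le> q" for y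
  proof -
    have "finite (pairs C `` {y})"
      using finite_imageI[OF finite_pairs, of snd C] by (rule rev_finite_subset) force
    then have "card ((pairs C - bad - used p) `` {y}) \<le> card (pairs C `` {y})"
      by (rule card_mono) auto
    then show ?thesis using q(2)[of y] by linarith
  qed
  obtain Y g where Y: "finite Y" "?n / 10 ^ 5 \<le> real (card Y)"
    and g: "\<And>y. y \<in> Y \<Longrightarrow> (y, g y) \<in> pairs C - bad - used p"
    using exists_many_fibres[OF fin fib q(1) big] by blast
  show thesis
  proof (rule that[OF Y])
    fix y assume "y \<in> Y"
    note gy = g[OF this]
    then have V: "y \<in> V" "g y \<in> V" "g y \<noteq> y" "k y (g y) \<in> C" and nb: "y \<notin> Z'" "g y \<notin> Z'"
      by (auto simp: pairs_def bad_def)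
    show "y \<in> V - R \<and> p i y = i \<and> y \<notin> Z \<and> common (k i y)"
      using V nb i by (auto simp: Z'_def moved_def Q_def)
    show "g y \<in> V - R \<and> p i (g y) = i \<and> g y \<notin> Z \<and> g y \<noteq> y"
      using V nb by (auto simp: Z'_def moved_def)
    show "k y (g y) \<notin> cols p J i \<and> (y, g y) \<notin> used p"
      using V C gy by auto
  qed
qed

section \<open>Moves inside one tree, and taking in a root\<close>

lemma k_parent_in_cols: "y \<in> V - R \<Longrightarrow> k y (p i y) \<in> cols p J i"
  by (auto simp: cols_def)

text \<open>The move frees the common colour \<open>k i y\<close>, which makes up for the colour
  taken by the new edge, so \<open>slack\<close> survives. Its purpose is to make the tree give up
  one more edge at \<open>i\<close>.\<close>

lemma common_swap:
  assumes pack: "packing p J" and i: "i \<in> R"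
    and size: "\<And>i'. i' \<in> R \<Longrightarrow> card (moved p i') \<le> 7 * card R"
    and slack: "slack p J i" and J: "card (J i) < card R - 1"
  obtains p' where "packing p' J" "\<And>i'. i' \<noteq> i \<Longrightarrow> p' i' = p i'"
    and "card (moved p' i) = Suc (card (moved p i))" "slack p' J i"
proof -
  have iV: "i \<in> V" using i R_subset by auto
  obtain Y g where Y: "finite Y" "real (card V) / 10 ^ 5 \<le> real (card Y)"
    and 1: "\<And>y. y \<in> Y \<Longrightarrow> y \<in> V - R \<and> p i y = i \<and> y \<notin> {} \<and> common (k i y)"
    and 2: "\<And>y. y \<in> Y \<Longrightarrow> g y \<in> V - R \<and> p i (g y) = i \<and> g y \<notin> {} \<and> g y \<noteq> y"
    and 3: "\<And>y. y \<in> Y \<Longrightarrow> k y (g y) \<notin> cols p J i \<and> (y, g y) \<notin> used p"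
    by (rule pool[OF pack i size slack J, of "{}"]) auto
  have "Y \<noteq> {}" using Y card_V_pos by auto
  then obtain y where "y \<in> Y" by blast
  note y = 1[OF this] 2[OF this] 3[OF this]
  let ?p = "reattach p i y (g y)"
  have p': "packing ?p J" "cols ?p J i = insert (k y (g y)) (cols p J i - {k y (p i y)})"
    "moved ?p i = insert y (moved p i)"
    by (rule packing_reattach[OF pack i]; use y not_used_edge[OF pack] in auto)+
  have ky: "k y (p i y) = k i y" "k i y \<in> cols p J i"
    using y k_commute[of y i] k_parent_in_cols[of y p i J] by auto
  have "y \<noteq> i" using y i by auto
  then have "nfree i (cols p J i) \<le> nfree i (cols ?p J i)"
    using nfree_insert[OF iV, of "cols p J i - {k i y}" "k y (g y)"]
      nfree_remove[OF iV, of y "cols p J i"] y ky i by (simp add: p')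
  moreover have "y \<notin> moved p i" using y by (simp add: moved_def)
  then have "card (moved ?p i) = Suc (card (moved p i))" by (simp add: p')
  ultimately show thesis
    using that[of ?p] p'(1) slack by (auto simp: slack_def)
qed

text \<open>Blocked pairs are counted against the \<open>dsum i\<close> pairs of foreign colour. A pair is also
  unsuitable if both its ends are joined to \<open>i\<close> by uncommon colours; otherwise one orientation frees
  a common colour.\<close>

lemma foreign_swap:
  fixes T :: nat
  assumes poor: "\<not> rich" and pack: "packing p J" and i: "i \<in> R" "J i = {}"
    and size: "\<And>i'. i' \<in> R \<Longrightarrow> card (moved p i') \<le> T"
    and T: "0 < T" "real T * real (card V) ^ 2 \<le> 16 * real (card R) * \<Delta>"
  obtains p' where "packing p' J" "\<And>i'. i' \<noteq> i \<Longrightarrow> p' i' = p i'"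
    and "card (moved p' i) = Suc (card (moved p i))"
    and "nfree i (cols p' J i) = Suc (nfree i (cols p J i))"
proof -
  let ?n = "real (card V)" and ?m = "real (card R)"
  let ?N = "pairs (- col i)"
  define Q where "Q = {v \<in> V - {i}. \<not> common (k i v)}"
  define F where "F = (\<lambda>v. k v (p i v)) ` moved p i"
  have iV: "i \<in> V" using i R_subset by auto
  have npos: "?n > 0" using card_V_pos by simp
  have mpos: "?m > 0" using card_R_pos by simp
  have small: "4 * 10 ^ 11 * ?m \<le> ?n" by (rule R_small)
  have "0 < real T * ?n ^ 2" using T npos by simp
  then have "0 < ?m * \<Delta>" using T(2) by linarith
  then have D: "0 < \<Delta>" using mpos by (simp add: zero_less_mult_iff)
  have poor': "\<Delta> \<le> ?n * ?n / 10 ^ 4" using poor by (simp add: rich_def power2_eq_square)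
  have mD: "?m * \<Delta> / ?n \<le> \<Delta> / (4 * 10 ^ 11)"
    using mult_right_mono[OF small, of \<Delta>] D npos by (simp add: field_simps)
  \<comment> \<open>The bound on \<open>T\<close> makes \<open>?n * T\<close> a tiny fraction of
    \<open>\<Delta>\<close>, so it is harmless to discard all pairs at the moved vertices and in
    their colours.\<close>
  have nT: "?n * real T \<le> 16 * (\<Delta> / (4 * 10 ^ 11))"
  proof -
    have "?n * real T = (real T * ?n ^ 2) / ?n" using npos by (simp add: power2_eq_square)
    also have "\<dots> \<le> (16 * ?m * \<Delta>) / ?n" by (rule divide_right_mono[OF T(2)]) simp
    also have "\<dots> = 16 * (?m * \<Delta> / ?n)" by simp
    finally show ?thesis using mD by linarith
  qed
  have size_i: "card (moved p i) \<le> T" by (rule size[OF i(1)])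
  have F: "finite F" "card F \<le> T"
    using card_image_le[of "moved p i" "\<lambda>v. k v (p i v)"] size_i by (auto simp: F_def)
  have "card (pairs F) \<le> card V * T"
    using card_pairs_le[OF F(1)] F(2) by (meson mult_le_mono2 order_trans)
  from of_nat_mono[where ?'a = real, OF this] have bF: "real (card (pairs F)) \<le> ?n * real T" by simp
  let ?BR = "?N \<inter> {(y, z). y \<in> R \<or> z \<in> R}"
  \<comment> \<open>The crude bound \<open>?m * ?n\<close> could exceed a small
    \<open>\<Delta>\<close>. Two roots, however, miss at most \<open>4 * \<Delta> / ?n\<close> of
    each other's colours.\<close>
  have bR: "real (card ?BR) \<le> 8 * (?m * \<Delta> / ?n)"
  proof -
    have "real (card (col y \<inter> - col i)) \<le> 4 * \<Delta> / ?n" if y: "y \<in> R" for y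
    proof -
      have "y \<in> V" using y R_subset by auto
      from of_nat_mono[where ?'a = real, OF card_V_d_le[OF this iV]]
      have "?n * real (d y i) \<le> 4 * \<Delta>" using dsum_upper[OF y] dsum_upper[OF i(1)] by simp
      then show ?thesis using npos by (simp add: field_simps d_def Diff_eq)
    qed
    then have "(\<Sum>y\<in>R. real (card (col y \<inter> - col i))) \<le> ?m * (4 * \<Delta> / ?n)"
      by (rule sum_bounded_above)
    moreover have "real (card ?BR) \<le> 2 * (\<Sum>y\<in>R. real (card (col y \<inter> - col i)))"
      using of_nat_mono[where ?'a = real, OF card_pairs_meeting[OF finite_R, of "- col i"]] by simp
    ultimately show ?thesis by simp
  qed
  let ?BM = "?N \<inter> {(y, z). y \<in> moved p i \<or> z \<in> moved p i}"
  have "card ?BM \<le> 2 * (card V * T)"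
  proof -
    have "(\<Sum>y\<in>moved p i. card (col y \<inter> - col i)) \<le> card (moved p i) * card V"
      using sum_bounded_above[of "moved p i" "\<lambda>y. card (col y \<inter> - col i)" "card V"]
        card_col_Int_le by simp
    also have "\<dots> \<le> card V * T" using size_i by simp
    finally show ?thesis using card_pairs_meeting[of "moved p i" "- col i"] by simp
  qed
  from of_nat_mono[where ?'a = real, OF this] have bM: "real (card ?BM) \<le> 2 * (?n * real T)" by simp
  have "card (used p) \<le> card R * (2 * T)" by (rule card_used_le) (rule size)
  from of_nat_mono[where ?'a = real, OF this] have "real (card (used p)) \<le> 2 * (?m * real T)" by simp
  also have "\<dots> \<le> 2 * (?n * real T)" using small by (intro mult_left_mono mult_right_mono) auto
  finally have bU: "real (card (used p)) \<le> 2 * (?n * real T)" .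
  have finQ: "finite Q" by (simp add: Q_def finite_V)
  \<comment> \<open>\<open>Q\<close> has at most \<open>4 * \<Delta> / ?n\<close> elements; poverty
    turns the bound quadratic in \<open>\<Delta>\<close> into a linear one.\<close>
  have bQ: "real (card (Q \<times> Q)) \<le> 16 * \<Delta> / 10 ^ 4"
  proof -
    have q: "?n * real (card Q) \<le> 4 * \<Delta>" unfolding Q_def by (rule card_uncommon_poor[OF i(1) poor])
    have "(?n * real (card Q)) * (?n * real (card Q)) \<le> (4 * \<Delta>) * (4 * \<Delta>)"
      by (rule mult_mono[OF q q]) (use D in auto)
    also have "\<dots> \<le> 16 * \<Delta> * (?n * ?n / 10 ^ 4)"
      using mult_left_mono[OF poor', of "16 * \<Delta>"] D by simp
    finally have "(?n * ?n) * (real (card Q) * real (card Q)) \<le> (?n * ?n) * (16 * \<Delta> / 10 ^ 4)"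
      by (simp add: algebra_simps)
    then show ?thesis using npos finQ by (simp add: card_cartesian_product)
  qed
  define bad where "bad = pairs F \<union> ?BR \<union> ?BM \<union> used p \<union> Q \<times> Q"
  have "card bad \<le> card (pairs F) + card ?BR + card ?BM + card (used p) + card (Q \<times> Q)"
    unfolding bad_def
    using card_Un_le[of "pairs F \<union> ?BR \<union> ?BM \<union> used p" "Q \<times> Q"]
      card_Un_le[of "pairs F \<union> ?BR \<union> ?BM" "used p"]
      card_Un_le[of "pairs F \<union> ?BR" ?BM] card_Un_le[of "pairs F" ?BR] by linarith
  then have "real (card bad) \<le> real (card (pairs F)) + real (card ?BR) + real (card ?BM)
      + real (card (used p)) + real (card (Q \<times> Q))" by linarith
  \<comment> \<open>The total is at most 5 times \<open>?n * T\<close>, 8 times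
    \<open>?m * \<Delta> / ?n\<close> and \<open>16 * \<Delta> / 10^4\<close>.\<close>
  also have "\<dots> < \<Delta> / 2" using bF bR bM bU bQ nT mD D by simp
  also have "\<dots> \<le> real (card ?N)" using dsum_lower[OF i(1)] by (simp add: card_pairs_foreign[OF iV])
  finally have "\<not> ?N \<subseteq> bad"
    using card_mono[of bad ?N] finQ by (auto simp: bad_def)
  then obtain a b where ab: "(a, b) \<in> ?N" "(a, b) \<notin> bad" by auto
  then have "(b, a) \<in> ?N" "(b, a) \<notin> bad"
    using pairs_commute used_commute by (auto simp: bad_def)
  moreover have "a \<notin> Q \<or> b \<notin> Q" using ab by (auto simp: bad_def)
  ultimately obtain y z where yz: "(y, z) \<in> ?N" "(y, z) \<notin> bad" "y \<notin> Q" using ab by blast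
  then have V: "y \<in> V - R" "z \<in> V - R" "y \<noteq> z" and st: "p i y = i" "p i z = i"
    and nu: "(y, z) \<notin> used p" and fc: "k y z \<notin> col i" "k y z \<notin> F"
    by (auto simp: bad_def pairs_def moved_def)
  have nc: "k y z \<notin> cols p J i" using fc cols_subset[OF pack i(1)] by (auto simp: F_def i(2))
  let ?p = "reattach p i y z"
  have p': "packing ?p J" "cols ?p J i = insert (k y z) (cols p J i - {k y (p i y)})"
    "moved ?p i = insert y (moved p i)"
    by (rule packing_reattach[OF pack i(1)]; use V st nc nu not_used_edge[OF pack] in auto)+
  have ky: "k y (p i y) = k i y" "k i y \<in> cols p J i"
    using V st k_commute[of y i] k_parent_in_cols[of y p i J] by auto
  have "common (k i y)" using yz(3) V i by (auto simp: Q_def)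
  then have "nfree i (cols ?p J i) = Suc (nfree i (cols p J i))"
    unfolding p'(2) ky(1)
    using nfree_insert_foreign[OF iV fc(1)] nfree_remove[OF iV, of y "cols p J i"] V i ky by auto
  moreover have "y \<notin> moved p i" using st by (simp add: moved_def)
  then have "card (moved ?p i) = Suc (card (moved p i))" by (simp add: p')
  ultimately show thesis
    using that[of ?p] p'(1) by auto
qed

text \<open>Only about \<open>card R\<close> squared pairs are used, so few vertices can lie on
  linearly many of them. Colours of edges above such vertices are avoided when a root is taken in,
  since \<open>release_colour\<close> needs a light vertex.\<close>

lemma card_heavy:
  assumes size: "\<And>i. i \<in> R \<Longrightarrow> card (moved p i) \<le> 7 * card R"
  defines "H \<equiv> {y. real (card V) / 10 ^ 6 < real (card (used p `` {y}))}"
  shows "finite H" and "card H \<le> card R"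
proof -
  let ?n = "real (card V)" and ?m = "real (card R)"
  have npos: "?n > 0" using card_V_pos by simp
  have "H \<subseteq> fst ` used p"
  proof
    fix y assume "y \<in> H"
    then have "used p `` {y} \<noteq> {}" using npos by (auto simp: H_def)
    then show "y \<in> fst ` used p" by force
  qed
  then show fin: "finite H" by (rule finite_subset) simp
  have finI: "finite (used p `` {y})" for y
    using finite_imageI[OF finite_used, of snd p] by (rule rev_finite_subset) force
  have "card (used p) \<le> card R * (2 * (7 * card R))"
    by (rule card_used_le) (rule size)
  from of_nat_mono[where ?'a = real, OF this]
  have U: "real (card (used p)) \<le> 14 * (?m * ?m)" by simp
  have "real (card H) * (?n / 10 ^ 6) \<le> (\<Sum>y\<in>H. real (card (used p `` {y})))"
    by (rule sum_bounded_below) (simp add: H_def)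
  also have "\<dots> = real (card (SIGMA y:H. used p `` {y}))"
    using fin finI by (simp add: card_SigmaI)
  also have "\<dots> \<le> real (card (used p))"
    by (intro of_nat_mono card_mono) auto
  also have "\<dots> \<le> 14 * (?m * ?m)" by (rule U)
  finally have "real (card H) * ?n \<le> 14 * 10 ^ 6 * (?m * ?m)" by simp
  also have "\<dots> \<le> ?m * ?n"
  proof -
    have "?m * (14 * 10 ^ 6 * ?m) \<le> ?m * ?n"
      using R_small by (intro mult_left_mono) auto
    then show ?thesis by (simp add: mult_ac)
  qed
  finally show "card H \<le> card R" using npos by simp
qed

text \<open>To use the colour of the edge from \<open>y\<close> to its parent elsewhere, \<open>y\<close> is attached by a
  foreign colour if it sees many of those. Otherwise it is attached by the colour of some edge
  \<open>{i, y'}\<close>, and \<open>y'\<close> in turn by an unused colour.\<close>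

lemma release_colour:
  assumes pack: "packing p J" and i: "i \<in> R"
    and size: "\<And>i'. i' \<in> R \<Longrightarrow> card (moved p i') \<le> 7 * card R"
    and slack: "slack p J i" and J: "card (J i) < card R - 1"
    and y: "y \<in> V - R" and light: "real (card (used p `` {y})) \<le> real (card V) / 10 ^ 6"
  obtains p' c where "packing p' J" "\<And>i'. i' \<noteq> i \<Longrightarrow> p' i' = p i'"
    and "moved p i \<subseteq> moved p' i" "card (moved p' i) \<le> card (moved p i) + 2"
    and "k y (p i y) \<notin> cols p' J i" "insert (k y (p i y)) (cols p' J i) = insert c (cols p J i)"
\<comment> \<open>The threshold is half the size of the pool: if it is not reached, \<open>y\<close>
  sees at least half of the colours \<open>k i y'\<close> that the pool can free.\<close>
proof (cases "real (card V) / (2 * 10 ^ 5) \<le> real (d y i)")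
  case True
  let ?n = "real (card V)" and ?m = "real (card R)"
  define F where "F = (\<lambda>v. k v (p i v)) ` (moved p i \<union> J i)"
  have yV: "y \<in> V" and iV: "i \<in> V" using y i R_subset by auto
  have finJ: "finite (J i)" using finite_J pack i by blast
  have finU: "finite (used p `` {y})"
    using finite_imageI[OF finite_used, of snd p] by (rule rev_finite_subset) force
  have "card F \<le> card (moved p i \<union> J i)"
    unfolding F_def by (rule card_image_le) (use finJ in simp)
  also have "\<dots> \<le> card (moved p i) + card (J i)" by (rule card_Un_le)
  finally have F: "card F \<le> 8 * card R" using size[OF i] J by linarith
  have finF: "finite F" using finJ by (simp add: F_def)
  let ?S = "{z \<in> V - {y}. k y z \<notin> col i}" and ?SF = "{z \<in> V - {y}. k y z \<in> F}"
  let ?bad = "R \<union> moved p i \<union> used p `` {y} \<union> ?SF"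
  have "card ?SF \<le> card F"
    unfolding card_colour_nbrs[OF yV] using finF by (intro card_mono) auto
  moreover have "card ?bad \<le> card R + card (moved p i) + card (used p `` {y}) + card ?SF"
    using card_Un_le[of "R \<union> moved p i \<union> used p `` {y}" ?SF]
      card_Un_le[of "R \<union> moved p i" "used p `` {y}"] card_Un_le[of R "moved p i"] by linarith
  ultimately have "real (card ?bad) \<le> 16 * ?m + ?n / 10 ^ 6"
    using F light size[OF i] by linarith
  also have "\<dots> < ?n / (2 * 10 ^ 5)" using R_small card_V_pos by simp
  also have "\<dots> \<le> real (card ?S)" unfolding card_foreign_nbrs[OF yV] by (rule True)
  finally have "\<not> ?S \<subseteq> ?bad"
    using card_mono[of ?bad ?S] finU by (auto simp: finite_V)
  then obtain z where "z \<in> ?S" "z \<notin> ?bad" by blast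
  then have z: "z \<in> V - R" "z \<noteq> y" "p i z = i" "(y, z) \<notin> used p" "k y z \<notin> col i" "k y z \<notin> F"
    by (auto simp: moved_def)
  have nc: "k y z \<notin> cols p J i" using z cols_subset[OF pack i] by (auto simp: F_def)
  let ?p = "reattach p i y z"
  have p': "packing ?p J" "cols ?p J i = insert (k y z) (cols p J i - {k y (p i y)})"
    "moved ?p i = insert y (moved p i)"
    by (rule packing_reattach[OF pack i]; use y z nc not_used_edge[OF pack] in auto)+
  have yc: "k y (p i y) \<in> cols p J i" using y by (rule k_parent_in_cols)
  show thesis
  proof (rule that[of ?p "k y z"])
    show "card (moved ?p i) \<le> card (moved p i) + 2" by (simp add: p' card_insert_if)
    show "k y (p i y) \<notin> cols ?p J i" unfolding p' using nc yc by auto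
    show "insert (k y (p i y)) (cols ?p J i) = insert (k y z) (cols p J i)"
      unfolding p' using yc by auto
  qed (use p' in auto)
next
  case False
  let ?n = "real (card V)" and ?m = "real (card R)"
  have yV: "y \<in> V" and iV: "i \<in> V" using y i R_subset by auto
  have finU: "finite (used p `` {y})"
    using finite_imageI[OF finite_used, of snd p] by (rule rev_finite_subset) force
  have one: "real (card {y}) \<le> ?n / (2 * 10 ^ 5)"
    using R_small card_R_pos by simp
  \<comment> \<open>Excluding \<open>y\<close> from the pool keeps it out of both ends of the first
    move.\<close>
  obtain Y g where Y: "finite Y" "?n / 10 ^ 5 \<le> real (card Y)"
    and 1: "\<And>v. v \<in> Y \<Longrightarrow> v \<in> V - R \<and> p i v = i \<and> v \<notin> {y} \<and> common (k i v)"
    and 2: "\<And>v. v \<in> Y \<Longrightarrow> g v \<in> V - R \<and> p i (g v) = i \<and> g v \<notin> {y} \<and> g v \<noteq> v"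
    and 3: "\<And>v. v \<in> Y \<Longrightarrow> k v (g v) \<notin> cols p J i \<and> (v, g v) \<notin> used p"
    by (rule pool[OF pack i size slack J _ one]) auto
  have injY: "inj_on (k i) Y"
    by (rule inj_on_subset[OF k_inj_on[OF iV]]) (use 1 i in auto)
  have "card (k i ` Y - col y) \<le> d i y"
    unfolding d_def by (rule card_mono, simp) (use 1 i in \<open>auto simp: col_def\<close>)
  then have b1: "real (card (k i ` Y - col y)) < ?n / (2 * 10 ^ 5)"
    using False d_commute[OF iV yV] by linarith
  let ?bad = "R \<union> moved p i \<union> used p `` {y}"
  have "card ?bad \<le> card R + card (moved p i) + card (used p `` {y})"
    using card_Un_le[of "R \<union> moved p i" "used p `` {y}"] card_Un_le[of R "moved p i"] by linarith
  moreover have "card (k y ` ?bad) \<le> card ?bad" by (rule card_image_le) (simp add: finU)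
  ultimately have b2: "real (card (k y ` ?bad)) \<le> 8 * ?m + ?n / 10 ^ 6"
    using light size[OF i] by linarith
  have "card ((k i ` Y - col y) \<union> k y ` ?bad) \<le> card (k i ` Y - col y) + card (k y ` ?bad)"
    by (rule card_Un_le)
  \<comment> \<open>Fewer than half of the pool colours are missing at \<open>y\<close>, and about a
    tenth are blocked there, so one can be used to attach \<open>y\<close>.\<close>
  then have "real (card ((k i ` Y - col y) \<union> k y ` ?bad)) < ?n / 10 ^ 5"
    using b1 b2 R_small card_V_pos by simp
  also have "\<dots> \<le> real (card (k i ` Y))" using Y by (simp add: card_image injY)
  finally have "\<not> k i ` Y \<subseteq> (k i ` Y - col y) \<union> k y ` ?bad"
    using card_mono[of "(k i ` Y - col y) \<union> k y ` ?bad" "k i ` Y"] Y(1) finU by auto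
  then obtain y2 where y2: "y2 \<in> Y" "k i y2 \<in> col y" "k i y2 \<notin> k y ` ?bad" by blast
  have "k i y2 \<in> k y ` (V - {y})" using y2(2) by (simp only: col_def)
  then obtain z where z: "z \<in> V - {y}" "k y z = k i y2" by (metis imageE)
  have "z \<notin> ?bad" using y2(3) z(2) by (metis imageI)
  then have zb: "z \<in> V - R" "z \<noteq> y" "p i z = i" "(y, z) \<notin> used p"
    using z(1) by (auto simp: moved_def)
  note y2' = 1[OF y2(1)] 2[OF y2(1)] 3[OF y2(1)]
  have sw: "k y2 (p i y2) = k i y2" "k i y2 \<in> cols p J i"
    using y2' k_commute[of y2 i] k_parent_in_cols[of y2 p i J] by auto
  \<comment> \<open>Otherwise the edges from \<open>y2\<close> to \<open>y\<close> and to
    \<open>i\<close> would have the same colour.\<close>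
  have "z \<noteq> y2"
  proof
    assume "z = y2"
    then have "k y2 y = k y2 i" using z k_commute[of y y2] k_commute[of i y2] by simp
    then show False using k_inj[of y2 y i] y2' iV yV y i by auto
  qed
  have neq: "k y (p i y) \<noteq> k y2 (p i y2)"
  proof
    assume "k y (p i y) = k y2 (p i y2)"
    moreover have "inj_on (\<lambda>v. k v (p i v)) (V - R \<union> J i)"
      using packing_wf[OF pack i] by (simp add: wf_tree_def)
    ultimately have "y = y2" using y y2' by (auto simp: inj_on_def)
    then show False using y2' by simp
  qed
  let ?c = "k y2 (g y2)" and ?p = "reattach p i y2 (g y2)"
  have p1: "packing ?p J" "cols ?p J i = insert ?c (cols p J i - {k y2 (p i y2)})"
    "moved ?p i = insert y2 (moved p i)"
    by (rule packing_reattach[OF pack i]; use y2' not_used_edge[OF pack] in auto)+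
  \<comment> \<open>The first move has just freed \<open>k i y2\<close>, which is the colour
    \<open>k y z\<close>. It changed only the tree of \<open>i\<close>, so disjointness of
    \<open>{y, z}\<close> from the other trees can still be read off \<open>p\<close>.\<close>
  let ?q = "reattach ?p i y z"
  have p2: "packing ?q J" "cols ?q J i = insert (k y z) (cols ?p J i - {k y (?p i y)})"
    "moved ?q i = insert y (moved ?p i)"
  proof -
    have "k y z \<notin> cols ?p J i" unfolding p1 using z sw y2' by auto
    moreover have "{y, z} \<notin> edges ?p J i'" if "i' \<in> R - {i}" for i'
      using that not_used_edge[OF pack, of i' y z] y zb by simp
    moreover have "?p i z = i" using zb \<open>z \<noteq> y2\<close> by simp
    ultimately show "packing ?q J" "cols ?q J i = insert (k y z) (cols ?p J i - {k y (?p i y)})"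
      "moved ?q i = insert y (moved ?p i)"
      using packing_reattach[OF p1(1) i y, of z] zb by blast+
  qed
  have q: "cols ?q J i = insert (k i y2) (insert ?c (cols p J i - {k i y2}) - {k y (p i y)})"
    unfolding p2 p1 sw z(2) using y2' by auto
  have yc: "k y (p i y) \<in> cols p J i" using y by (rule k_parent_in_cols)
  show thesis
  proof (rule that[of ?q ?c])
    show "packing ?q J" by (rule p2)
    show "card (moved ?q i) \<le> card (moved p i) + 2" unfolding p2 p1 by (simp add: card_insert_if)
    show "moved p i \<subseteq> moved ?q i" unfolding p2 p1 by auto
    show "k y (p i y) \<notin> cols ?q J i" unfolding q using neq sw by auto
    show "insert (k y (p i y)) (cols ?q J i) = insert ?c (cols p J i)"
      unfolding q using neq sw y2' yc by auto
  qed auto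
qed

lemma attach_root:
  assumes pack: "packing p J" and i: "i \<in> R" and j: "j \<in> R - {i}" "j \<notin> J i"
    and size: "\<And>i'. i' \<in> R \<Longrightarrow> card (moved p i') \<le> 7 * card R"
    and many: "5 * card R \<le> card (moved p j)"
    and slack: "slack p J i"
  defines "J' \<equiv> J(i := insert j (J i))"
  obtains p' where "packing p' J'" "\<And>i'. i' \<noteq> i \<Longrightarrow> p' i' = p i'"
    and "card (moved p i) \<le> card (moved p' i)" "card (moved p' i) \<le> card (moved p i) + 2"
    and "slack p' J' i"
proof -
  let ?n = "real (card V)" and ?m = "real (card R)"
  have iV: "i \<in> V" and jV: "j \<in> V" using i j R_subset by auto
  have finJ: "finite (J i)" using finite_J pack i by blast
  have "J i \<subset> R - {i}" using J_subset[OF pack i] j by auto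
  then have "card (J i) < card (R - {i})" by (intro psubset_card_mono) auto
  then have J: "card (J i) < card R - 1" using i by simp
  define H where "H = {y. ?n / 10 ^ 6 < real (card (used p `` {y}))}"
  have H: "finite H" "card H \<le> card R" using card_heavy[OF size] by (auto simp: H_def)
  define C where "C = (\<lambda>v. k v (p i v)) ` (J i \<union> H)"
  have "card C \<le> card (J i \<union> H)" unfolding C_def by (rule card_image_le) (use finJ H in auto)
  also have "\<dots> \<le> card (J i) + card H" by (rule card_Un_le)
  finally have C: "card C \<le> 2 * card R" using J H by linarith
  have finC: "finite C" using finJ H by (simp add: C_def)
  let ?bad = "(\<lambda>i'. p i' j) ` R \<union> {x \<in> V - {j}. k j x \<in> C}"
  have "card {x \<in> V - {j}. k j x \<in> C} \<le> card C"
    unfolding card_colour_nbrs[OF jV] using finC by (intro card_mono) auto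
  \<comment> \<open>At most \<open>card R\<close> vertices already serve as parents of
    \<open>j\<close>, and at most \<open>2 * card R\<close> have a colour that sits above a root or
    a heavy vertex in the tree of \<open>i\<close>, where it could not be released.\<close>
  then have "card ?bad < 5 * card R"
    using card_Un_le[of "(\<lambda>i'. p i' j) ` R" "{x \<in> V - {j}. k j x \<in> C}"]
      card_image_le[OF finite_R, of "\<lambda>i'. p i' j"] C card_R_pos by linarith
  then have "\<not> moved p j \<subseteq> ?bad"
    using many card_mono[of ?bad "moved p j"] by (auto simp: finite_V)
  then obtain x where x: "x \<in> moved p j" "x \<notin> ?bad" by blast
  then have xV: "x \<in> V - R" "p j x \<noteq> j" "k j x \<notin> C" "x \<noteq> j" using j by (auto simp: moved_def)
  have free: "{j, x} \<notin> edges p J i'" if i': "i' \<in> R" for i'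
  proof
    assume "{j, x} \<in> edges p J i'"
    then obtain v where v: "v \<in> V - R \<union> J i'" "{j, x} = {v, p i' v}" by (auto simp: edges_def)
    then consider "v = j" "x = p i' j" | "v = x" "p i' x = j" by (auto simp: doubleton_eq_iff)
    then show False
    proof cases
      case 1 then show False using x i' by auto
    next
      case 2
      then have "p i' x = i'" using packing_wf[OF pack i'] xV j by (auto simp: wf_tree_def)
      then show False using 2 xV by simp
    qed
  qed
  \<comment> \<open>If \<open>k j x\<close> is absent, nothing is moved and \<open>c\<close> is that
    colour itself.\<close>
  obtain p1 c where p1: "packing p1 J" "\<And>i'. i' \<noteq> i \<Longrightarrow> p1 i' = p i'"
    "moved p i \<subseteq> moved p1 i" "card (moved p1 i) \<le> card (moved p i) + 2"
    "k j x \<notin> cols p1 J i" "insert (k j x) (cols p1 J i) = insert c (cols p J i)"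
  proof (cases "k j x \<in> cols p J i")
    case False
    then show ?thesis using that[of p "k j x"] pack by auto
  next
    case True
    then obtain y where y: "y \<in> V - R \<union> J i" "k j x = k y (p i y)" by (auto simp: cols_def)
    then have "y \<in> V - R" "y \<notin> H" using xV by (auto simp: C_def)
    then show ?thesis
      using release_colour[OF pack i size slack J, of y] that unfolding y(2)
      by (auto simp: H_def not_less)
  qed
  let ?q = "reattach p1 i j x"
  have free1: "{j, x} \<notin> edges p1 J i'" if "i' \<in> R - {i}" for i'
    using free[of i'] that p1(2)[of i'] by (simp add: edges_def)
  have q: "packing ?q J'" "cols ?q J' i = insert (k j x) (cols p1 J i)" "moved ?q i = moved p1 i"
    using packing_add_root[OF p1(1) i j xV(1) p1(5) free1] by (auto simp: J'_def)
  have cJ: "card (J' i) = Suc (card (J i))" using j finJ by (simp add: J'_def)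
  show thesis
  proof (rule that[of ?q])
    show "card (moved p i) \<le> card (moved ?q i)" unfolding q by (rule card_mono) (use p1 in auto)
    show "card (moved ?q i) \<le> card (moved p i) + 2" unfolding q by (rule p1)
    show "slack ?q J' i"
      using slack nfree_insert[OF iV, of "cols p J i" c] cJ unfolding slack_def q(2) p1(6) by auto
  qed (use q p1 in auto)
qed

end

section \<open>Construction of the packing\<close>

text \<open>Each stage of the construction repeats a step that keeps an invariant and lowers a
  measure until the goal is reached.\<close>

lemma exists_by_descent:
  fixes f :: "'s \<Rightarrow> nat"
  assumes "I s" and step: "\<And>s. I s \<Longrightarrow> \<not> G s \<Longrightarrow> \<exists>s'. I s' \<and> f s' < f s"
  shows "\<exists>s. I s \<and> G s"
  using assms(1)
proof (induction "f s" arbitrary: s rule: less_induct)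
  case less
  then show ?case using step by blast
qed

text \<open>Take a set with the fewest inner edges: exchanging \<open>i\<close> for \<open>w\<close> cannot reduce their number.\<close>

lemma exists_locally_sparse:
  fixes E :: "'a \<Rightarrow> 'a \<Rightarrow> bool"
  assumes fin: "finite G" and m: "m \<le> card G" and sym: "\<And>u v. E u v \<longleftrightarrow> E v u"
  obtains R where "R \<subseteq> G" "card R = m"
    "\<And>i w. i \<in> R \<Longrightarrow> w \<in> G - R \<Longrightarrow> card {v \<in> R - {i}. E i v} \<le> card {v \<in> R. E w v}"
proof -
  \<comment> \<open>Ordered pairs off the diagonal are counted, so adding a vertex adds twice its
    degree.\<close>
  define e where "e A = card {(u, v) \<in> A \<times> A. u \<noteq> v \<and> E u v}" for A
  have e_insert: "e (insert x A) = e A + 2 * card {v \<in> A. E x v}"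
    if "finite A" "x \<notin> A" for x A
  proof -
    let ?X = "Pair x ` {v \<in> A. E x v}" and ?E = "{(u, v) \<in> A \<times> A. u \<noteq> v \<and> E u v}"
    have finE: "finite ?E" by (rule finite_subset[of _ "A \<times> A"]) (use that in auto)
    have "{(u, v) \<in> insert x A \<times> insert x A. u \<noteq> v \<and> E u v} = ?E \<union> (?X \<union> prod.swap ` ?X)"
      using that sym by (auto simp: image_iff)
    then have "e (insert x A) = card (?E \<union> (?X \<union> prod.swap ` ?X))" by (simp add: e_def)
    also have "\<dots> = card ?E + card (?X \<union> prod.swap ` ?X)"
      using that finE by (intro card_Un_disjoint) auto
    also have "card (?X \<union> prod.swap ` ?X) = card ?X + card (prod.swap ` ?X)"
      using that by (intro card_Un_disjoint) auto
    also have "card ?X + card (prod.swap ` ?X) = 2 * card {v \<in> A. E x v}"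
      by (simp add: card_image inj_on_def)
    finally show ?thesis by (simp add: e_def)
  qed
  obtain R0 where "R0 \<subseteq> G" "card R0 = m" using m fin by (meson obtain_subset_with_card_n)
  then obtain R where R: "R \<subseteq> G \<and> card R = m"
    and min: "\<And>A. A \<subseteq> G \<and> card A = m \<Longrightarrow> e R \<le> e A"
    using ex_has_least_nat[of "\<lambda>A. A \<subseteq> G \<and> card A = m" R0 e] by blast
  show thesis
  proof (rule that)
    fix i w assume i: "i \<in> R" and w: "w \<in> G - R"
    have finR: "finite R" by (rule finite_subset[OF _ fin]) (use R in simp)
    have "card (insert w (R - {i})) = m" using i w R finR card_Suc_Diff1[OF finR i] by simp
    then have "e R \<le> e (insert w (R - {i}))" using R w by (intro min) auto
    moreover have "e R = e (R - {i}) + 2 * card {v \<in> R - {i}. E i v}"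
      using e_insert[of "R - {i}" i] finR i by (simp add: insert_absorb)
    moreover have "e (insert w (R - {i})) = e (R - {i}) + 2 * card {v \<in> R - {i}. E w v}"
      using e_insert[of "R - {i}" w] finR w by simp
    moreover have "card {v \<in> R - {i}. E w v} \<le> card {v \<in> R. E w v}"
      using finR by (intro card_mono) auto
    ultimately show "card {v \<in> R - {i}. E i v} \<le> card {v \<in> R. E w v}" by linarith
  qed (use R in auto)
qed

section \<open>Stages of the construction: gaining slack, building a reserve, taking in all
  roots\<close>

context root_system
begin

lemma sum_decrease:
  fixes f g :: "'a \<Rightarrow> nat"
  assumes "i \<in> R" "f i < g i" "\<And>i'. i' \<noteq> i \<Longrightarrow> f i' = g i'"
  shows "sum f R < sum g R"
proof (rule sum_strict_mono_ex1)
  show "\<forall>x\<in>R. f x \<le> g x" using assms by (metis less_imp_le order_refl)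
qed (use assms in auto)

text \<open>In the star at \<open>i\<close>, the common colours towards other roots are free;
  exactly the \<open>B i\<close> rare ones are lacking. Each foreign swap adds one free common
  colour, so \<open>B i\<close> swaps suffice. In the rich case the stars themselves do.\<close>

lemma exists_slack_packing:
  "\<exists>p J. packing p J \<and> (\<forall>i\<in>R. J i = {} \<and> card (moved p i) \<le> card R \<and> slack p J i)"
proof (cases rich)
  case True
  then show ?thesis
    using packing_stars by (intro exI[of _ "\<lambda>i v. i"] exI[of _ "\<lambda>_. {}"]) (auto simp: slack_def moved_def)
next
  case poor: False
  define J :: "'a \<Rightarrow> 'a set" where "J = (\<lambda>_. {})"
  define B where "B i = card {j \<in> R - {i}. 100 * card (pairs {k i j}) < card V}" for i
  have uncommon: "\<not> common (k i j) \<longleftrightarrow> 100 * card (pairs {k i j}) < card V" for i j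
    using poor by (auto simp: common_def)
  define I where "I p \<longleftrightarrow> packing p J \<and> (\<forall>i\<in>R. card (moved p i) \<le> B i \<and>
    card R - 1 + card (moved p i) \<le> nfree i (cols p J i) + B i)" for p
  have "I (\<lambda>i v. i)"
    unfolding I_def
  proof (intro conjI ballI)
    show "packing (\<lambda>i v. i) J" unfolding J_def by (rule packing_stars)
    fix i assume i: "i \<in> R"
    have m: "moved (\<lambda>i v. i) i = {}" by (simp add: moved_def)
    then show "card (moved (\<lambda>i v. i) i) \<le> B i" by simp
    have "{j \<in> R - {i}. common (k i j)}
        \<subseteq> {v \<in> V - {i}. common (k i v) \<and> k i v \<notin> cols (\<lambda>i v. i) J i}"
    proof
      fix j assume "j \<in> {j \<in> R - {i}. common (k i j)}"
      then have j: "j \<in> R" "j \<noteq> i" "common (k i j)" by auto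
      have "k i j \<noteq> k v i" if "v \<in> V - R" for v
        using k_inj[of i j v] that i j R_subset k_commute[of v i] by auto
      then have "k i j \<notin> cols (\<lambda>i v. i) J i" by (auto simp: cols_def J_def)
      then show "j \<in> {v \<in> V - {i}. common (k i v) \<and> k i v \<notin> cols (\<lambda>i v. i) J i}"
        using j R_subset by auto
    qed
    then have "card {j \<in> R - {i}. common (k i j)} \<le> nfree i (cols (\<lambda>i v. i) J i)"
      unfolding nfree_def by (intro card_mono) (simp_all add: finite_V)
    moreover have "card (R - {i}) = card {j \<in> R - {i}. common (k i j)} + B i"
    proof -
      have "R - {i} = {j \<in> R - {i}. common (k i j)} \<union> {j \<in> R - {i}. \<not> common (k i j)}" by auto
      then have "card (R - {i}) = card ({j \<in> R - {i}. common (k i j)} \<union> {j \<in> R - {i}. \<not> common (k i j)})"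
        by (rule arg_cong)
      also have "\<dots> = card {j \<in> R - {i}. common (k i j)} + card {j \<in> R - {i}. \<not> common (k i j)}"
        by (rule card_Un_disjoint) auto
      finally show ?thesis by (simp add: B_def uncommon)
    qed
    ultimately show "card R - 1 + card (moved (\<lambda>i v. i) i) \<le> nfree i (cols (\<lambda>i v. i) J i) + B i"
      using i m by simp
  qed
  then have "\<exists>p. I p \<and> (\<forall>i\<in>R. card (moved p i) = B i)"
  proof (rule exists_by_descent[where I = I and f = "\<lambda>p. \<Sum>i\<in>R. B i - card (moved p i)"])
    fix p assume p: "I p" and "\<not> (\<forall>i\<in>R. card (moved p i) = B i)"
    then obtain i where "i \<in> R" "card (moved p i) \<noteq> B i" by blast
    moreover have le: "card (moved p i) \<le> B i" if "i \<in> R" for i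
      using p that by (simp add: I_def)
    ultimately have i: "i \<in> R" "card (moved p i) < B i" by (auto intro: le_neq_trans)
    \<comment> \<open>The maximum is attained at a root, so \<open>sparse_in_R\<close> bounds it,
      and it dominates \<open>moved\<close> in all trees at once.\<close>
    define T where "T = Max (B ` R)"
    have T: "B i' \<le> T" if "i' \<in> R" for i' using that by (simp add: T_def)
    have "T \<in> B ` R" unfolding T_def using R_nonempty by (intro Max_in) auto
    then have "real T * real (card V) ^ 2 \<le> 16 * real (card R) * \<Delta>"
      using sparse_in_R by (auto simp: B_def)
    moreover have "0 < T" using T[OF i(1)] i by linarith
    moreover have "card (moved p i') \<le> T" if "i' \<in> R" for i'
      using le[OF that] T[OF that] by linarith
    moreover have "packing p J" using p by (simp add: I_def)
    moreover have "J i = {}" by (simp add: J_def)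
    ultimately obtain p' where p': "packing p' J" "\<And>i'. i' \<noteq> i \<Longrightarrow> p' i' = p i'"
      "card (moved p' i) = Suc (card (moved p i))"
      "nfree i (cols p' J i) = Suc (nfree i (cols p J i))"
      using foreign_swap[OF poor _ i(1), of p J T] by metis
    have same: "moved p' i' = moved p i'" "cols p' J i' = cols p J i'" if "i' \<noteq> i" for i'
      using p'(2)[OF that] by (simp_all add: moved_def cols_def)
    have "I p'"
      unfolding I_def
    proof (intro conjI ballI)
      show "packing p' J" by (rule p')
      fix i' assume "i' \<in> R"
      then have "card (moved p i') \<le> B i'"
        "card R - 1 + card (moved p i') \<le> nfree i' (cols p J i') + B i'"
        using p by (auto simp: I_def)
      then show "card (moved p' i') \<le> B i'"
        "card R - 1 + card (moved p' i') \<le> nfree i' (cols p' J i') + B i'"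
        using i p' same[of i'] by (cases "i' = i"; simp)+
    qed
    moreover have "(\<Sum>i\<in>R. B i - card (moved p' i)) < (\<Sum>i\<in>R. B i - card (moved p i))"
      using i p' same by (intro sum_decrease[of i]) auto
    ultimately show "\<exists>p'. I p' \<and> (\<Sum>i\<in>R. B i - card (moved p' i)) < (\<Sum>i\<in>R. B i - card (moved p i))"
      by blast
  qed
  then obtain p where p: "I p" "\<And>i. i \<in> R \<Longrightarrow> card (moved p i) = B i" by blast
  have "B i \<le> card R" for i unfolding B_def by (rule card_mono) auto
  moreover have "slack p J i" if "i \<in> R" for i
  proof -
    have "card R - 1 + card (moved p i) \<le> nfree i (cols p J i) + B i"
      using p(1) that by (simp add: I_def)
    then show ?thesis using p(2)[OF that] by (simp add: slack_def)
  qed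
  ultimately have "\<forall>i\<in>R. J i = {} \<and> card (moved p i) \<le> card R \<and> slack p J i"
    using p(2) by (simp add: J_def)
  moreover have "packing p J" using p(1) by (simp add: I_def)
  ultimately show ?thesis by blast
qed

text \<open>The \<open>5 * card R\<close> edges given up at each root exceed the fewer than
  \<open>5 * card R\<close> choices that \<open>attach_root\<close> excludes. With two roots or
  more, every tree still lacks one, as \<open>common_swap\<close> requires.\<close>

lemma exists_reserve_packing:
  assumes two: "2 \<le> card R"
  shows "\<exists>p J. packing p J \<and> (\<forall>i\<in>R. J i = {} \<and> card (moved p i) = 5 * card R \<and> slack p J i)"
proof -
  obtain p0 J where p0: "packing p0 J"
    "\<And>i. i \<in> R \<Longrightarrow> J i = {} \<and> card (moved p0 i) \<le> card R \<and> slack p0 J i"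
    using exists_slack_packing by blast
  define I where "I p \<longleftrightarrow> packing p J \<and> (\<forall>i\<in>R. card (moved p i) \<le> 5 * card R \<and> slack p J i)" for p
  have "I p0"
    unfolding I_def
  proof (intro conjI ballI)
    fix i assume "i \<in> R"
    from p0(2)[OF this] show "card (moved p0 i) \<le> 5 * card R" "slack p0 J i" by linarith+
  qed (rule p0)
  then have "\<exists>p. I p \<and> (\<forall>i\<in>R. card (moved p i) = 5 * card R)"
  proof (rule exists_by_descent[where I = I and f = "\<lambda>p. \<Sum>i\<in>R. 5 * card R - card (moved p i)"])
    fix p assume p: "I p" and "\<not> (\<forall>i\<in>R. card (moved p i) = 5 * card R)"
    then obtain i where "i \<in> R" "card (moved p i) \<noteq> 5 * card R" by blast
    moreover have inv: "card (moved p i) \<le> 5 * card R" "slack p J i" if "i \<in> R" for i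
      using p that by (simp_all add: I_def)
    ultimately have i: "i \<in> R" "card (moved p i) < 5 * card R" by (auto intro: le_neq_trans)
    have pack: "packing p J" using p by (simp add: I_def)
    have size: "card (moved p i') \<le> 7 * card R" if "i' \<in> R" for i'
      using inv(1)[OF that] by linarith
    obtain p' where p': "packing p' J" "\<And>i'. i' \<noteq> i \<Longrightarrow> p' i' = p i'"
      "card (moved p' i) = Suc (card (moved p i))" "slack p' J i"
      using common_swap[OF pack i(1) size inv(2)[OF i(1)]] two p0(2)[OF i(1)] by auto
    have same: "moved p' i' = moved p i'" "slack p' J i' = slack p J i'" if "i' \<noteq> i" for i'
      using p'(2)[OF that] by (simp_all add: moved_def cols_def slack_def)
    have "I p'"
      unfolding I_def
    proof (intro conjI ballI)
      show "packing p' J" by (rule p')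
      fix i' assume "i' \<in> R"
      then have "card (moved p i') \<le> 5 * card R" "slack p J i'" using p by (auto simp: I_def)
      then show "card (moved p' i') \<le> 5 * card R" "slack p' J i'"
        using i p' same[of i'] by (cases "i' = i"; simp)+
    qed
    moreover have "(\<Sum>i\<in>R. 5 * card R - card (moved p' i)) < (\<Sum>i\<in>R. 5 * card R - card (moved p i))"
      using i p' same by (intro sum_decrease[of i]) auto
    ultimately show "\<exists>p'. I p' \<and>
        (\<Sum>i\<in>R. 5 * card R - card (moved p' i)) < (\<Sum>i\<in>R. 5 * card R - card (moved p i))"
      by blast
  qed
  then obtain p where "I p" "\<forall>i\<in>R. card (moved p i) = 5 * card R" by blast
  then have "packing p J \<and> (\<forall>i\<in>R. J i = {} \<and> card (moved p i) = 5 * card R \<and> slack p J i)"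
    using p0(2) by (simp add: I_def)
  then show ?thesis by blast
qed

lemma exists_full_packing:
  assumes two: "2 \<le> card R"
  shows "\<exists>p J. packing p J \<and> (\<forall>i\<in>R. J i = R - {i})"
proof -
  \<comment> \<open>Each of the at most \<open>card R - 1\<close> roots taken in adds at most two
    moved vertices, which keeps \<open>moved\<close> within the \<open>7 * card R\<close> tolerated
    by the moves. The lower bound preserves the reserve at every root.\<close>
  define I where "I = (\<lambda>(p, J). packing p J \<and> (\<forall>i\<in>R. 5 * card R \<le> card (moved p i) \<and>
    card (moved p i) \<le> 5 * card R + 2 * card (J i) \<and> slack p J i))"
  define f where "f = (\<lambda>(p :: 'a \<Rightarrow> 'a \<Rightarrow> 'a, J). \<Sum>i\<in>R. card R - card (J i :: 'a set))"
  obtain p0 J0 where p0: "packing p0 J0"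
    "\<And>i. i \<in> R \<Longrightarrow> J0 i = {} \<and> card (moved p0 i) = 5 * card R \<and> slack p0 J0 i"
    using exists_reserve_packing[OF two] by blast
  then have "I (p0, J0)" by (simp add: I_def)
  then have "\<exists>s. I s \<and> (\<forall>i\<in>R. snd s i = R - {i})"
  proof (rule exists_by_descent[where I = I and f = f])
    fix s assume s: "I s" and ns: "\<not> (\<forall>i\<in>R. snd s i = R - {i})"
    obtain p J where pJ: "s = (p, J)" by (cases s)
    have pack: "packing p J" and inv: "\<And>i. i \<in> R \<Longrightarrow> 5 * card R \<le> card (moved p i) \<and>
      card (moved p i) \<le> 5 * card R + 2 * card (J i) \<and> slack p J i"
      using s by (auto simp: I_def pJ)
    have Jsub: "J i \<subseteq> R - {i}" if "i \<in> R" for i using pack that by (rule J_subset)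
    have cJ: "card (J i) < card R" if "i \<in> R" for i
    proof -
      have "card (J i) \<le> card (R - {i})" using Jsub[OF that] by (intro card_mono) auto
      then show ?thesis using that two by simp
    qed
    obtain i where i: "i \<in> R" "J i \<noteq> R - {i}" using ns pJ by auto
    then obtain j where j: "j \<in> R - {i}" "j \<notin> J i" using Jsub by blast
    have size: "card (moved p i') \<le> 7 * card R" if "i' \<in> R" for i'
      using inv[OF that] cJ[OF that] by linarith
    let ?J = "J(i := insert j (J i))"
    obtain p' where p': "packing p' ?J" "\<And>i'. i' \<noteq> i \<Longrightarrow> p' i' = p i'"
      "card (moved p i) \<le> card (moved p' i)" "card (moved p' i) \<le> card (moved p i) + 2"
      "slack p' ?J i"
      using attach_root[OF pack i(1) j size] inv i j by blast
    have same: "moved p' i' = moved p i'" "slack p' ?J i' = slack p J i'" if "i' \<noteq> i" for i'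
      using p'(2)[OF that] that by (simp_all add: moved_def cols_def slack_def)
    have cJ': "card (insert j (J i)) = Suc (card (J i))"
      using j finite_J[OF pack i(1)] by simp
    have "I (p', ?J)"
      unfolding I_def prod.case
    proof (intro conjI ballI)
      show "packing p' ?J" by (rule p')
      fix i' assume "i' \<in> R"
      then show "5 * card R \<le> card (moved p' i')"
        "card (moved p' i') \<le> 5 * card R + 2 * card (?J i')" "slack p' ?J i'"
        using inv[of i'] p' same[of i'] cJ' by (cases "i' = i"; simp)+
    qed
    moreover have "f (p', ?J) < f s"
      unfolding f_def pJ prod.case using cJ' cJ[OF i(1)] i by (intro sum_decrease[of i]) auto
    ultimately show "\<exists>s'. I s' \<and> f s' < f s" by blast
  qed
  then show ?thesis by (auto simp: I_def)
qed

end

section \<open>Choice of the roots\<close>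

context proper_colouring
begin

text \<open>By Markov's inequality, at least half of the vertices have \<open>dsum\<close> at most
  twice the average. Among these, a set that is locally sparse for the graph of rare-coloured edges
  is chosen.\<close>

lemma exists_root_system:
  assumes m: "m > 0" "4 * 10 ^ 11 * real m \<le> real (card V)"
  shows "\<exists>R \<Delta>. card R = m \<and> root_system V k R \<Delta>"
proof -
  let ?n = "real (card V)"
  define \<Delta> where "\<Delta> = (\<Sum>v\<in>V. real (dsum v)) / ?n"
  define G where "G = {v \<in> V. real (dsum v) \<le> 2 * \<Delta>}"
  have mpos: "real m > 0" using m(1) by simp
  have m': "400000000000 * real m \<le> ?n" using m(2) by simp
  then have npos: "?n > 0" using mpos by linarith
  have \<Delta>: "?n * \<Delta> = (\<Sum>v\<in>V. real (dsum v))" using npos by (simp add: \<Delta>_def)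
  have "\<Delta> \<ge> 0" by (simp add: \<Delta>_def sum_nonneg)
  have finG: "finite G" by (simp add: G_def finite_V)
  have G: "?n / 2 \<le> real (card G)"
  \<comment> \<open>Markov's inequality divides by \<open>\<Delta>\<close>; if it vanishes, so does
    every \<open>dsum\<close>.\<close>
  proof (cases "\<Delta> = 0")
    case True
    then have "\<forall>v\<in>V. real (dsum v) = 0"
      using \<Delta> by (subst sum_nonneg_eq_0_iff[symmetric]) (auto simp: finite_V)
    then have "G = V" using True by (auto simp: G_def)
    then show ?thesis by simp
  next
    case False
    then have pos: "\<Delta> > 0" using \<open>\<Delta> \<ge> 0\<close> by simp
    have "real (card (V - G)) * (2 * \<Delta>) \<le> (\<Sum>v\<in>V - G. real (dsum v))"
      by (rule sum_bounded_below) (auto simp: G_def)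
    also have "\<dots> \<le> (\<Sum>v\<in>V. real (dsum v))"
      by (rule sum_mono2) (auto simp: finite_V)
    finally have "\<Delta> * (2 * real (card (V - G))) \<le> \<Delta> * ?n" by (simp add: \<Delta>[symmetric] mult_ac)
    then have "2 * real (card (V - G)) \<le> ?n" using pos by simp
    moreover have "card V = card G + card (V - G)"
      using card_Diff_subset[OF finG, of V] card_mono[OF finite_V, of G] by (auto simp: G_def)
    ultimately show ?thesis by simp
  qed
  define E where "E u v \<longleftrightarrow> 100 * card (pairs {k u v}) < card V" for u v
  have symE: "E u v \<longleftrightarrow> E v u" for u v by (simp add: E_def k_commute[of u v])
  have mG: "m \<le> card G" using G m' by linarith
  obtain R where R: "R \<subseteq> G" "card R = m"
    and sparse: "\<And>i w. i \<in> R \<Longrightarrow> w \<in> G - R \<Longrightarrow> card {v \<in> R - {i}. E i v} \<le> card {v \<in> R. E w v}"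
    using exists_locally_sparse[of G m E, OF finG mG symE] by blast
  have RV: "R \<subseteq> V" using R by (auto simp: G_def)
  have finR: "finite R" using RV finite_V finite_subset by blast
  have deg: "real (card {v \<in> V - {u}. E u v}) \<le> 4 * \<Delta> / ?n" if u: "u \<in> R" for u
  proof -
    have uV: "u \<in> V" using u RV by auto
    have "card V * card (col u \<inter> {c. 100 * card (pairs {c}) < card V}) \<le> 2 * dsum u"
      by (rule sparse_colours_le[OF uV]) auto
    from of_nat_mono[where ?'a = real, OF this]
    have "?n * real (card {v \<in> V - {u}. E u v}) \<le> 2 * real (dsum u)"
      using card_colour_nbrs[OF uV, of "{c. 100 * card (pairs {c}) < card V}"] by (simp add: E_def)
    also have "\<dots> \<le> 4 * \<Delta>" using u R by (auto simp: G_def)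
    finally show ?thesis using npos by (simp add: field_simps)
  qed
  have sparse_R: "real (card {v \<in> R - {i}. E i v}) * ?n ^ 2 \<le> 16 * real m * \<Delta>" if i: "i \<in> R" for i
  proof -
    let ?x = "card {v \<in> R - {i}. E i v}"
    \<comment> \<open>By local sparsity, every \<open>w\<close> in \<open>G - R\<close> has at least
      \<open>?x\<close> rare edges to \<open>R\<close>. Counting these edges from \<open>R\<close>
      brings in the degrees bounded by \<open>deg\<close>.\<close>
    have "card (G - R) * ?x \<le> (\<Sum>w\<in>G - R. card {v \<in> R. E w v})"
      using sum_bounded_below[of "G - R" ?x "\<lambda>w. card {v \<in> R. E w v}"] sparse[OF i] by simp
    also have "\<dots> = (\<Sum>v\<in>R. card {w \<in> G - R. E w v})"
      using finG finR by (intro sum_multicount_gen) auto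
    also have "\<dots> \<le> (\<Sum>u\<in>R. card {v \<in> V - {u}. E u v})"
      by (intro sum_mono card_mono) (auto simp: finite_V G_def symE)
    finally have "card (G - R) * ?x \<le> (\<Sum>u\<in>R. card {v \<in> V - {u}. E u v})" .
    from of_nat_mono[where ?'a = real, OF this]
    have "real (card (G - R)) * real ?x \<le> (\<Sum>u\<in>R. real (card {v \<in> V - {u}. E u v}))" by simp
    also have "\<dots> \<le> real (card R) * (4 * \<Delta> / ?n)" by (rule sum_bounded_above) (rule deg)
    finally have 1: "real (card (G - R)) * real ?x \<le> 4 * real m * \<Delta> / ?n" using R by (simp add: mult_ac)
    have "card (G - R) = card G - m" using R finR by (simp add: card_Diff_subset)
    then have "?n / 4 \<le> real (card (G - R))" using G m by simp
    then have "?n / 4 * real ?x \<le> real (card (G - R)) * real ?x" by (rule mult_right_mono) simp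
    then have "?n / 4 * real ?x \<le> 4 * real m * \<Delta> / ?n" using 1 by linarith
    then show ?thesis using npos by (simp add: field_simps power2_eq_square)
  qed
  have "root_system V k R \<Delta>"
  proof unfold_locales
    show "R \<subseteq> V" by (rule RV)
    show "4 * 10 ^ 11 * real (card R) \<le> ?n" using m R by simp
    show "R \<noteq> {}" using m R by auto
    fix i assume i: "i \<in> R"
    then have iV: "i \<in> V" using RV by auto
    from of_nat_mono[where ?'a = real, OF sum_dsum_le[OF iV]]
    have "?n * \<Delta> \<le> ?n * (2 * real (dsum i))" by (simp add: \<Delta>)
    then show "\<Delta> / 2 \<le> real (dsum i)" using npos by simp
    show "real (dsum i) \<le> 2 * \<Delta>" using i R by (auto simp: G_def)
    show "real (card {j \<in> R - {i}. 100 * card (pairs {k i j}) < card V}) * ?n ^ 2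
        \<le> 16 * real (card R) * \<Delta>"
      using sparse_R[OF i] R by (simp add: E_def)
  qed
  then show ?thesis using R by blast
qed

end

section \<open>From packings to rainbow spanning trees\<close>

context rooted_colouring
begin

lemma packing_tree:
  assumes pack: "packing p J" and i: "i \<in> R" "J i = R - {i}"
  shows "ug_tree (V, edges p J i)" and "inj_on (\<lambda>v. k v (p i v)) (V - {i})"
    and "edges p J i = (\<lambda>v. {v, p i v}) ` (V - {i})"
proof -
  have D: "V - R \<union> J i = V - {i}" using i R_subset by auto
  have wf: "wf_tree p J i" using pack i(1) by (rule packing_wf)
  then obtain \<rho> :: "'a \<Rightarrow> nat" where \<rho>: "\<And>v. v \<in> V - R \<union> J i \<Longrightarrow> \<rho> (p i v) < \<rho> v"
    unfolding wf_tree_def by blast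
  show e: "edges p J i = (\<lambda>v. {v, p i v}) ` (V - {i})" unfolding edges_def D ..
  show "inj_on (\<lambda>v. k v (p i v)) (V - {i})" using wf unfolding wf_tree_def D by blast
  have W: "\<And>v. v \<in> V - R \<Longrightarrow> p i v = i \<or> p i v \<in> V - R" "\<And>v. v \<in> J i \<Longrightarrow> p i v \<in> V - R"
    using wf by (simp_all add: wf_tree_def)
  show "ug_tree (V, edges p J i)"
    unfolding e
  proof (rule ug_tree_parents[OF finite_V])
    show iV: "i \<in> V" using i(1) R_subset by auto
    fix v assume v: "v \<in> V - {i}"
    then have "v \<in> V - R \<or> v \<in> J i" using D by blast
    then have "p i v \<in> V" using W[of v] iV by auto
    then show "p i v \<in> V \<and> \<rho> (p i v) < \<rho> v" using \<rho>[of v] v D by simp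
  qed
qed

end

lemma rainbow_spanning_trees_if_packing:
  fixes c :: "'a set \<Rightarrow> 'c"
  assumes rc: "rooted_colouring V (\<lambda>u v. c {u, v}) R"
    and pack: "rooted_colouring.packing V (\<lambda>u v. c {u, v}) R p J" and J: "\<And>i. i \<in> R \<Longrightarrow> J i = R - {i}"
  shows "\<exists>\<T> :: 'a ugraph set. finite \<T> \<and> card \<T> = card R \<and>
    (\<forall>T\<in>\<T>. rainbow_spanning_tree c (complete_ugraph V) T) \<and>
    pairwise (\<lambda>S T. ug_edges S \<inter> ug_edges T = {}) \<T>"
proof -
  interpret rooted_colouring V "\<lambda>u v. c {u, v}" R by (rule rc)
  define T where "T i = (V, edges p J i)" for i
  note tree = packing_tree[OF pack _ J]
  have disj: "ug_edges (T i) \<inter> ug_edges (T i') = {}" if "i \<in> R" "i' \<in> R" "i \<noteq> i'" for i i'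
    using pack that by (simp add: packing_def T_def)
  have "inj_on T R"
  \<comment> \<open>Equal trees of two different roots would be disjoint from themselves, hence
    without edges; but with a second root, \<open>V - {i}\<close> is not empty.\<close>
  proof (rule inj_onI, rule ccontr)
    fix i i' assume i: "i \<in> R" "i' \<in> R" "T i = T i'" "i \<noteq> i'"
    then have "edges p J i = {}" using disj[of i i'] by (simp add: T_def)
    then show False using tree(3)[of i] i R_subset by auto
  qed
  then have "card (T ` R) = card R" by (rule card_image)
  moreover have "rainbow_spanning_tree c (complete_ugraph V) (T i)" if i: "i \<in> R" for i
    unfolding rainbow_spanning_tree_def
  proof (intro conjI)
    show t: "ug_tree (T i)" unfolding T_def by (rule tree(1)[OF i i])
    then have "simple_ugraph (T i)" by (simp add: ug_tree_def)
    then show "ug_subgraph (T i) (complete_ugraph V)"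
      by (auto simp: simple_ugraph_def ug_subgraph_def complete_ugraph_def T_def)
    show "ug_verts (T i) = ug_verts (complete_ugraph V)" by (simp add: T_def complete_ugraph_def)
    have "inj_on c ((\<lambda>v. {v, p i v}) ` (V - {i}))"
      using tree(2)[OF i i] by (auto simp: inj_on_def)
    then show "rainbow c (T i)" using tree(3)[OF i i] by (simp add: rainbow_def T_def)
  qed
  moreover have "pairwise (\<lambda>S T. ug_edges S \<inter> ug_edges T = {}) (T ` R)"
    using disj by (auto simp: pairwise_def)
  ultimately show ?thesis by (intro exI[of _ "T ` R"]) simp
qed

lemma proper_colouring_complete_ugraph:
  fixes c :: "'a set \<Rightarrow> 'c"
  assumes "finite V" "proper_edge_colouring c (complete_ugraph V)"
  shows "proper_colouring V (\<lambda>u v. c {u, v})"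
proof
  show "finite V" by (rule assms)
  show "c {u, v} = c {v, u}" for u v by (simp add: insert_commute)
  fix u v w assume uvw: "u \<in> V" "v \<in> V" "w \<in> V" "v \<noteq> u" "w \<noteq> u" "c {u, v} = c {u, w}"
  show "v = w"
  proof (rule ccontr)
    assume "v \<noteq> w"
    then have ne: "{u, v} \<noteq> {u, w} \<and> {u, v} \<inter> {u, w} \<noteq> {}" by (auto simp: doubleton_eq_iff)
    have "{u, v} \<in> ug_edges (complete_ugraph V)" "{u, w} \<in> ug_edges (complete_ugraph V)"
      using uvw by (simp_all add: complete_ugraph_def)
    from assms(2)[unfolded proper_edge_colouring_def, rule_format, OF this ne]
    show False using uvw(6) by simp
  qed
qed

theorem theorem1p1:
  fixes n :: nat and V :: "'a set" and c :: "'a set \<Rightarrow> 'c"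
  assumes "n > 0"
    and "finite V" and "card V = n"
    and "proper_edge_colouring c (complete_ugraph V)"
  shows "\<exists>\<T> :: 'a ugraph set.
           finite \<T> \<and>
           real (card \<T>) \<ge> real n / 10 ^ 12 \<and>
           (\<forall>T\<in>\<T>. rainbow_spanning_tree c (complete_ugraph V) T) \<and>
           pairwise (\<lambda>S T. ug_edges S \<inter> ug_edges T = {}) \<T>"
proof -
  let ?k = "\<lambda>u v. c {u, v}"
  interpret proper_colouring V ?k
    using assms(2,4) by (rule proper_colouring_complete_ugraph)
  have "\<exists>R p J. rooted_colouring V ?k R \<and> rooted_colouring.packing V ?k R p J \<and>
      (\<forall>i\<in>R. J i = R - {i}) \<and> real n / 10 ^ 12 \<le> real (card R)"
  \<comment> \<open>Here one tree is enough: with a single root, the star is already a full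
    packing.\<close>
  proof (cases "n \<le> 10 ^ 12")
    case True
    obtain r where r: "r \<in> V" using assms by (metis all_not_in_conv card.empty less_irrefl)
    interpret R: rooted_colouring V ?k "{r}" by unfold_locales (use r in simp)
    have "real n \<le> 10 ^ 12" using True of_nat_mono[where ?'a = real, OF True] by simp
    then show ?thesis
      using R.rooted_colouring_axioms R.packing_stars
      by (intro exI[of _ "{r}"] exI[of _ "\<lambda>i v. i"] exI[of _ "\<lambda>_. {}"]) auto
  next
    case False
    \<comment> \<open>Rounding up gives \<open>m < 2 * n / 10^12\<close> as
      \<open>n > 10^12\<close>, which leaves room for the factor \<open>4 * 10^11\<close>; it also
      gives the two roots needed above.\<close>
    define m where "m = nat \<lceil>real n / 10 ^ 12\<rceil>"
    have big: "real n > 10 ^ 12"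
      using False by (metis not_le of_nat_less_iff of_nat_numeral of_nat_power)
    have "real m = of_int \<lceil>real n / 10 ^ 12\<rceil>" by (simp add: m_def)
    then have m: "real n / 10 ^ 12 \<le> real m" "real m \<le> real n / 10 ^ 12 + 1"
      using le_of_int_ceiling[of "real n / 10 ^ 12"] of_int_ceiling_le_add_one[of "real n / 10 ^ 12"]
      by simp_all
    then have "real m > 1" using big by simp
    then have m2: "2 \<le> m" by linarith
    obtain R \<Delta> where R: "card R = m" "root_system V ?k R \<Delta>"
      using exists_root_system[of m] m m2 big assms(3) by auto
    interpret R: root_system V ?k R \<Delta> by (rule R)
    obtain p J where "R.packing p J" "\<forall>i\<in>R. J i = R - {i}"
      using R.exists_full_packing R(1) m2 by auto
    then show ?thesis
      using R(1) m(1) R.rooted_colouring_axioms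
      by (intro exI[of _ R] exI[of _ p] exI[of _ J]) simp
  qed
  then obtain R p J where R: "rooted_colouring V ?k R" "rooted_colouring.packing V ?k R p J"
    "\<forall>i\<in>R. J i = R - {i}" "real n / 10 ^ 12 \<le> real (card R)"
    by (elim exE conjE)
  then have "\<exists>\<T> :: 'a ugraph set. finite \<T> \<and> card \<T> = card R \<and>
      (\<forall>T\<in>\<T>. rainbow_spanning_tree c (complete_ugraph V) T) \<and>
      pairwise (\<lambda>S T. ug_edges S \<inter> ug_edges T = {}) \<T>"
    by (intro rainbow_spanning_trees_if_packing[OF R(1,2)]) simp
  then obtain \<T> :: "'a ugraph set" where "finite \<T>" "card \<T> = card R"
    "\<forall>T\<in>\<T>. rainbow_spanning_tree c (complete_ugraph V) T"
    "pairwise (\<lambda>S T. ug_edges S \<inter> ug_edges T = {}) \<T>" by (elim exE conjE)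
  then show ?thesis using R(4) by (intro exI[of _ \<T>] conjI) simp_all
qed

end
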